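(* Let $\alpha\in(0,1]$. There is an algorithm for non-clairvoyant scheduling with a single untrusted signal on $m$ parallel identical machines that is $(1+\alpha)$-consistent and $(1+\frac1\alpha)$-robust for minimizing the total completion time.
   Context: There are $n$ jobs with unknown processing times $p_j>0$, all available at time $0$, and $m$ identical machines. A schedule assigns at each time $t$ a rate $R_j^t\in[0,1]$ to each unfinished job with $\sum_jR_j^t\le m$ (equivalently, preemptive schedules in which each machine processes at most one job and each job runs on at most one machine at a time); the elapsed time is $e_j(t)=\int_0^tR_j^{t'}dt'$ and the completion time $C_j$ is the earliest $t$ with $e_j(t)\ge p_j$. Objective: $\mathrm{ALG}=\sum_jC_j$; $\mathrm{OPT}$ is the optimal value. Each job $j$ emits a single signal at the moment $e_j$ reaches $\beta_jp_j$, where $\beta_j\in[0,1]$ is unknown and $\alpha$ is the known announced value; the scheduler observes only signals and completions. $c$-consistent means $\mathrm{ALG}\le c\,\mathrm{OPT}$ whenever $\beta_j=\alpha$ for all $j$; $r$-robust means $\mathrm{ALG}\le r\,\mathrm{OPT}$ for all $(\beta_j)_j\in[0,1]^n$. *)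

theory Defs
  imports "HOL-Analysis.Analysis"
begin

text \<open>The jobs of an instance are the indices below \<open>num_jobs\<close>; values of \<open>proc\<close> and
  \<open>sig_frac\<close> at other indices play no role. Job \<open>j\<close> emits its signal when its elapsed time
  reaches \<open>sig_frac I j * proc I j\<close>.\<close>

record job_instance =
  num_jobs :: nat
  proc :: "nat \<Rightarrow> real"
  sig_frac :: "nat \<Rightarrow> real"

definition valid_instance :: "job_instance \<Rightarrow> bool" where
  "valid_instance I \<longleftrightarrow>
     (\<forall>j < num_jobs I. proc I j > 0 \<and> 0 \<le> sig_frac I j \<and> sig_frac I j \<le> 1)"

text \<open>\<open>R j t\<close> is the rate of job \<open>j\<close> at time \<open>t\<close>; only times \<open>t \<ge> 0\<close> matter.\<close>

type_synonym schedule = "nat \<Rightarrow> real \<Rightarrow> real"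

definition elapsed :: "schedule \<Rightarrow> nat \<Rightarrow> real \<Rightarrow> real" where
  "elapsed R j t = integral {0..t} (R j)"

definition signalled :: "job_instance \<Rightarrow> schedule \<Rightarrow> nat \<Rightarrow> real \<Rightarrow> bool" where
  "signalled I R j t \<longleftrightarrow> elapsed R j t \<ge> sig_frac I j * proc I j"

definition completed :: "job_instance \<Rightarrow> schedule \<Rightarrow> nat \<Rightarrow> real \<Rightarrow> bool" where
  "completed I R j t \<longleftrightarrow> elapsed R j t \<ge> proc I j"

text \<open>Only unfinished jobs receive a rate; this is expressed by giving finished jobs rate 0.\<close>

definition feasible :: "nat \<Rightarrow> job_instance \<Rightarrow> schedule \<Rightarrow> bool" where
  "feasible m I R \<longleftrightarrow>
     (\<forall>j < num_jobs I. \<forall>t \<ge> 0.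
        R j integrable_on {0..t} \<and> 0 \<le> R j t \<and> R j t \<le> 1 \<and>
        (completed I R j t \<longrightarrow> R j t = 0)) \<and>
     (\<forall>t \<ge> 0. (\<Sum>j < num_jobs I. R j t) \<le> real m)"

text \<open>The completion time is \<open>\<infinity>\<close> for a job that never finishes (infimum of the empty set).\<close>

definition completion_time :: "job_instance \<Rightarrow> schedule \<Rightarrow> nat \<Rightarrow> ereal" where
  "completion_time I R j = (INF t \<in> {t. t \<ge> 0 \<and> completed I R j t}. ereal t)"

definition total_completion_time :: "job_instance \<Rightarrow> schedule \<Rightarrow> ereal" where
  "total_completion_time I R = (\<Sum>j < num_jobs I. completion_time I R j)"

definition opt :: "nat \<Rightarrow> job_instance \<Rightarrow> ereal" where
  "opt m I = (INF R \<in> {R. feasible m I R}. total_completion_time I R)"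

text \<open>What the scheduler has seen by time \<open>t\<close>, beyond its own decisions: which jobs have
  emitted their signal, and which jobs have completed. An event that happens exactly at
  time \<open>t\<close> is visible at time \<open>t\<close>.\<close>

definition observation :: "job_instance \<Rightarrow> schedule \<Rightarrow> real \<Rightarrow> nat set \<times> nat set" where
  "observation I R t =
     ({j. j < num_jobs I \<and> signalled I R j t}, {j. j < num_jobs I \<and> completed I R j t})"

text \<open>A deterministic algorithm is given by the schedule it produces on every instance. It is
  non-clairvoyant if its rates at time \<open>t\<close> depend only on the number of jobs and on the
  observations made during \<open>{0..t}\<close>: runs on two instances that have looked the same up to
  time \<open>t\<close> must use the same rates at time \<open>t\<close>. Since elapsed times are continuous and events
  are visible at the moment they occur, the observations form a right-continuous step function
  with finitely many jumps. Hence two runs can diverge only after a signal or a completion has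
  actually told the two instances apart.\<close>

definition non_clairvoyant :: "(job_instance \<Rightarrow> schedule) \<Rightarrow> bool" where
  "non_clairvoyant A \<longleftrightarrow>
     (\<forall>I I' t. valid_instance I \<and> valid_instance I' \<and> num_jobs I = num_jobs I' \<and> t \<ge> 0 \<and>
        (\<forall>s \<in> {0..t}. observation I (A I) s = observation I' (A I') s) \<longrightarrow>
        (\<forall>j < num_jobs I. A I j t = A I' j t))"

definition signal_algorithm :: "nat \<Rightarrow> (job_instance \<Rightarrow> schedule) \<Rightarrow> bool" where
  "signal_algorithm m A \<longleftrightarrow>
     (\<forall>I. valid_instance I \<longrightarrow> feasible m I (A I)) \<and> non_clairvoyant A"

definition consistent :: "nat \<Rightarrow> real \<Rightarrow> real \<Rightarrow> (job_instance \<Rightarrow> schedule) \<Rightarrow> bool" where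
  "consistent m \<alpha> c A \<longleftrightarrow>
     (\<forall>I. valid_instance I \<and> (\<forall>j < num_jobs I. sig_frac I j = \<alpha>) \<longrightarrow>
        total_completion_time I (A I) \<le> ereal c * opt m I)"

definition robust :: "nat \<Rightarrow> real \<Rightarrow> (job_instance \<Rightarrow> schedule) \<Rightarrow> bool" where
  "robust m r A \<longleftrightarrow>
     (\<forall>I. valid_instance I \<longrightarrow> total_completion_time I (A I) \<le> ereal r * opt m I)"

end

theory Submission
  imports Defs
begin

text \<open>The algorithm runs round-robin on the unfinished jobs, but promotes a job whose signal
  arrives at elapsed time \<open>s\<close> to a machine of its own until its elapsed time reaches the predicted
  processing time \<open>s / \<alpha>\<close>; at most \<open>m\<close> promoted jobs run at once, those with small \<open>s\<close> first.
  All comparisons are with \<open>F = (\<Sum>j. p j * (z j div m + 1))\<close>, where \<open>z j\<close> is the number of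
  jobs longer than \<open>j\<close>, with ties broken by index. At any time the weights \<open>x div m + 1\<close>,
  placed on the unfinished jobs in order of completion, give every rate vector a value of at
  most the number of unfinished jobs; integration and a rearrangement argument give \<open>F \<le> opt\<close>.

  Robustness: while job \<open>j\<close> waits for full speed all machines are busy, so \<open>m * C j\<close> is at most
  \<open>m * p j\<close> plus the work done on other jobs before \<open>C j\<close>. For two jobs with \<open>p j \<le> p i\<close>, job \<open>j\<close>
  delays \<open>i\<close> by at most \<open>p j\<close>, and \<open>i\<close> delays \<open>j\<close> by at most \<open>p j / \<alpha>\<close>.

  Consistency: with perfect predictions the promoted jobs are the shortest unfinished ones. If
  the work on unpromoted jobs is counted twice, the weighted rates are at least the number of
  unfinished jobs at any time. The first count integrates to \<open>F\<close>, the second to \<open>\<alpha> * F\<close>.\<close>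

subsection \<open>Ranks, weights and a lower bound on the optimum\<close>

definition lex_less :: "(nat \<Rightarrow> real) \<Rightarrow> nat \<Rightarrow> nat \<Rightarrow> bool" where
  "lex_less f i j \<longleftrightarrow> f i < f j \<or> (f i = f j \<and> i < j)"

text \<open>Ranks count from the top, so the largest value has rank 0. \<open>f\<close> will be the
  processing times, the finishing times or the signal levels.\<close>

definition job_rank :: "(nat \<Rightarrow> real) \<Rightarrow> nat set \<Rightarrow> nat \<Rightarrow> nat" where
  "job_rank f A j = card {i \<in> A. lex_less f j i}"

lemma rank_strict_decreasing:
  assumes "finite A" "j \<in> A" "lex_less f i j"
  shows "job_rank f A j < job_rank f A i"
  unfolding job_rank_def
proof (rule psubset_card_mono)
  show "{k \<in> A. lex_less f j k} \<subset> {k \<in> A. lex_less f i k}"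
    using assms by (auto simp: lex_less_def)
qed (use assms in auto)

lemma rank_less_card:
  assumes "finite A" "j \<in> A"
  shows "job_rank f A j < card A"
  unfolding job_rank_def
  by (rule psubset_card_mono) (use assms in \<open>auto simp: lex_less_def\<close>)

lemma bij_betw_rank:
  assumes "finite A"
  shows "bij_betw (job_rank f A) A {..<card A}"
proof -
  have inj: "inj_on (job_rank f A) A"
  proof (rule inj_onI)
    fix i j assume "i \<in> A" "j \<in> A" "job_rank f A i = job_rank f A j"
    moreover have "i = j \<or> lex_less f i j \<or> lex_less f j i"
      by (auto simp: lex_less_def)
    ultimately show "i = j"
      using rank_strict_decreasing[OF assms] by (metis less_irrefl)
  qed
  have "job_rank f A ` A = {..<card A}"
    by (rule card_subset_eq) (use rank_less_card[OF assms] card_image[OF inj] in auto)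
  with inj show ?thesis by (simp add: bij_betw_def)
qed

text \<open>Whatever exceeds a member of an upper set lies in that set too, so dropping the rest of
  \<open>A\<close> changes no rank there. Counting from the top is what makes this work.\<close>

lemma rank_upper_set:
  assumes "T \<subseteq> A" "\<And>i j. i \<in> T \<Longrightarrow> j \<in> A \<Longrightarrow> f i \<le> f j \<Longrightarrow> j \<in> T" "j \<in> T"
  shows "job_rank f A j = job_rank f T j"
proof -
  have "{i \<in> A. lex_less f j i} = {i \<in> T. lex_less f j i}"
    using assms by (fastforce simp: lex_less_def)
  thus ?thesis by (simp add: job_rank_def)
qed

lemma rank_mono:
  assumes "T \<subseteq> A" "finite A"
  shows "job_rank f T j \<le> job_rank f A j"
  unfolding job_rank_def by (rule card_mono) (use assms in auto)

lemma sum_rank: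
  assumes "finite A"
  shows "(\<Sum>j\<in>A. g (job_rank f A j)) = (\<Sum>x<card A. g x)"
  by (rule sum.reindex_bij_betw[OF bij_betw_rank[OF assms]])

lemma sum_rank_upper_set:
  assumes "T \<subseteq> A" "finite A" "\<And>i j. i \<in> T \<Longrightarrow> j \<in> A \<Longrightarrow> f i \<le> f j \<Longrightarrow> j \<in> T"
  shows "(\<Sum>j\<in>T. g (job_rank f A j)) = (\<Sum>x<card T. g x)"
proof -
  have "(\<Sum>j\<in>T. g (job_rank f A j)) = (\<Sum>j\<in>T. g (job_rank f T j))"
    using rank_upper_set[OF assms(1), of f] assms(3) by (intro sum.cong) auto
  thus ?thesis using sum_rank[of T g f] finite_subset[OF assms(1,2)] by simp
qed

text \<open>Distinct naturals in increasing order dominate 0, 1, 2, ... termwise: the largest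
  element of a finite set is at least the number of the others.\<close>

lemma sum_inj_ge:
  fixes g :: "nat \<Rightarrow> real"
  assumes "finite T" "inj_on x T" "mono g"
  shows "(\<Sum>k<card T. g k) \<le> (\<Sum>j\<in>T. g (x j))"
proof -
  have *: "(\<Sum>k<card X. g k) \<le> (\<Sum>k\<in>X. g k)" if "finite X" for X :: "nat set"
    using that
  proof (induction X rule: finite_linorder_max_induct)
    case (insert b X)
    have "card X \<le> b"
      using card_mono[of "{..<b}" X] insert by auto
    hence "g (card X) \<le> g b" using \<open>mono g\<close> by (rule monoD[rotated])
    moreover have "b \<notin> X" using insert by auto
    ultimately show ?case using insert by simp
  qed simp
  show ?thesis
    using *[of "x ` T"] assms by (simp add: card_image sum.reindex)
qed

text \<open>Translates a count of predecessors, as in the priority test of \<open>rate\<close>, into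
  a rank.\<close>

lemma card_lex_predecessors:
  assumes "finite A" "j \<in> A"
  shows "card {i \<in> A. lex_less f i j} + job_rank f A j + 1 = card A"
proof -
  have "card A = card ({i \<in> A. lex_less f i j} \<union> {i \<in> A. lex_less f j i} \<union> {j})"
    by (rule arg_cong[where f = card]) (use assms in \<open>auto simp: lex_less_def\<close>)
  also have "\<dots> = card ({i \<in> A. lex_less f i j} \<union> {i \<in> A. lex_less f j i}) + card {j}"
    by (rule card_Un_disjoint) (use assms in \<open>auto simp: lex_less_def\<close>)
  also have "card ({i \<in> A. lex_less f i j} \<union> {i \<in> A. lex_less f j i})
      = card {i \<in> A. lex_less f i j} + job_rank f A j"
    unfolding job_rank_def
    by (rule card_Un_disjoint) (use assms in \<open>auto simp: lex_less_def\<close>)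
  finally show ?thesis by simp
qed

text \<open>Abel summation over the super-level sets of \<open>p\<close>.\<close>

lemma sum_mult_le_of_upper_sets:
  fixes p a b :: "nat \<Rightarrow> real"
  assumes "finite S" "\<And>j. j \<in> S \<Longrightarrow> 0 \<le> p j"
    and "\<And>T. T \<subseteq> S \<Longrightarrow> (\<And>i j. i \<in> T \<Longrightarrow> j \<in> S \<Longrightarrow> p i \<le> p j \<Longrightarrow> j \<in> T) \<Longrightarrow>
           (\<Sum>j\<in>T. a j) \<le> (\<Sum>j\<in>T. b j)"
  shows "(\<Sum>j\<in>S. p j * a j) \<le> (\<Sum>j\<in>S. p j * b j)"
  using assms
proof (induction "card S" arbitrary: S p rule: less_induct)
  case less
  show ?case
  proof (cases "S = {}")
    case False
    define d where "d = Min (p ` S)"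
    define S' where "S' = {j \<in> S. d < p j}"
    have d_le: "d \<le> p j" if "j \<in> S" for j
      using that less.prems(1) by (simp add: d_def)
    have d: "d \<in> p ` S" unfolding d_def by (rule Min_in) (use False less.prems in auto)
    hence "S' \<subset> S" by (auto simp: S'_def)
    hence "card S' < card S" using less.prems(1) by (rule psubset_card_mono[rotated])
    \<comment> \<open>An upper set of \<open>S'\<close> is also one of \<open>S\<close>, because the
      jobs outside \<open>S'\<close> sit at the minimum \<open>d\<close>.\<close>
    hence IH: "(\<Sum>j\<in>S'. (p j - d) * a j) \<le> (\<Sum>j\<in>S'. (p j - d) * b j)"
    proof (rule less.hyps)
      show "(\<Sum>j\<in>T. a j) \<le> (\<Sum>j\<in>T. b j)"
        if "T \<subseteq> S'" "\<And>i j. i \<in> T \<Longrightarrow> j \<in> S' \<Longrightarrow> p i - d \<le> p j - d \<Longrightarrow> j \<in> T" for T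
        by (rule less.prems(3)) (use that in \<open>fastforce simp: S'_def\<close>)+
    qed (use less.prems in \<open>auto simp: S'_def\<close>)
    have split: "(\<Sum>j\<in>S. p j * c j) = d * (\<Sum>j\<in>S. c j) + (\<Sum>j\<in>S'. (p j - d) * c j)" for c
    proof -
      have "(\<Sum>j\<in>S. p j * c j) = d * (\<Sum>j\<in>S. c j) + (\<Sum>j\<in>S. (p j - d) * c j)"
        by (simp add: sum_distrib_left flip: sum.distrib) (simp add: algebra_simps)
      also have "(\<Sum>j\<in>S. (p j - d) * c j) = (\<Sum>j\<in>S'. (p j - d) * c j)"
        by (rule sum.mono_neutral_right) (use less.prems d_le in \<open>force simp: S'_def\<close>)+
      finally show ?thesis .
    qed
    have "0 \<le> d" using d less.prems(2) by auto
    moreover have "(\<Sum>j\<in>S. a j) \<le> (\<Sum>j\<in>S. b j)" by (rule less.prems(3)) auto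
    ultimately show ?thesis using IH by (simp add: split add_mono mult_left_mono)
  qed simp
qed

section \<open>Weights of ranks and the shortest-first cost\<close>

definition load :: "nat \<Rightarrow> nat \<Rightarrow> real" where
  "load m x = real (x div m) + 1"

lemma load_mono: "x \<le> y \<Longrightarrow> load m x \<le> load m y"
  by (simp add: load_def div_le_mono)

lemma load_ge_1: "1 \<le> load m x"
  by (simp add: load_def)

lemma load_nonneg: "0 \<le> load m x"
  by (simp add: load_def)

text \<open>Moving the window one step trades \<open>load m a\<close> for
  \<open>load m (a + m)\<close>, which is larger by one. With \<open>a + m = n\<close>, full rate on
  the \<open>m\<close> highest of \<open>n\<close> ranks is worth exactly \<open>n\<close>.\<close>

lemma sum_load_window:
  assumes "m \<ge> 1"
  shows "(\<Sum>x\<in>{a..<a + m}. load m x) = real (a + m)"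
proof (induction a)
  case 0
  show ?case by (simp add: load_def)
next
  case (Suc a)
  have "(\<Sum>x\<in>{Suc a..<Suc a + m}. load m x) + load m a
      = (\<Sum>x\<in>{a..<a + m}. load m x) + load m (a + m)"
    using assms sum.atLeast_Suc_lessThan[of a "a + m" "load m"]
    by (simp add: sum.atLeastLessThan_Suc)
  also have "load m (a + m) = load m a + 1" using assms by (simp add: load_def)
  finally show ?case using Suc by simp
qed

text \<open>Over a full block the residues average \<open>(m - 1) / 2\<close>; the product makes up
  for the last, incomplete block.\<close>

lemma two_sum_mod:
  assumes "m \<ge> 1"
  shows "2 * (\<Sum>x<n. real (x mod m)) + real (n mod m) * (real m - real (n mod m))
       = real n * (real m - 1)"
proof (induction n)
  case (Suc n)
  have "n mod m < m" using assms by simp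
  show ?case
  proof (cases "Suc (n mod m) = m")
    case True
    hence "Suc n mod m = 0" by (simp add: mod_Suc)
    moreover have n: "real (n mod m) = real m - 1" using True by linarith
    ultimately show ?thesis using Suc unfolding n by (simp add: n algebra_simps)
  next
    case False
    hence "Suc n mod m = Suc (n mod m)" by (simp add: mod_Suc)
    thus ?thesis using Suc by (simp add: algebra_simps)
  qed
qed simp

text \<open>Since \<open>m * load m x = x - x mod m + m\<close>, it suffices that the residues
  average at most \<open>(m - 1) / 2\<close>. This links the integer weights to linear delays of the
  form rank / \<open>m\<close> in both ratio bounds.\<close>

lemma sum_load_ge:
  assumes "m \<ge> 1"
  shows "real n * (1 + (real n - 1) / real m) \<le> 2 * (\<Sum>x<n. load m x)"
proof -
  have m: "real m > 0" using assms by simp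
  have "real m * load m x = real x - real (x mod m) + real m" for x
  proof -
    have "real (m * (x div m) + x mod m) = real x" by simp
    thus ?thesis unfolding load_def of_nat_add of_nat_mult by (simp add: algebra_simps)
  qed
  hence "real m * (\<Sum>x<n. load m x) = (\<Sum>x<n. real x) - (\<Sum>x<n. real (x mod m)) + real n * real m"
    by (simp add: sum_distrib_left sum.distrib sum_subtractf)
  moreover have "2 * (\<Sum>x<n. real x) = real n * (real n - 1)"
    by (induction n) (simp_all add: algebra_simps)
  moreover have "0 \<le> real (n mod m) * (real m - real (n mod m))"
    using assms by (simp add: less_imp_le)
  ultimately have "real n * (real m + (real n - 1)) \<le> real m * (2 * (\<Sum>x<n. load m x))"
    using two_sum_mod[OF assms, of n] by (simp add: algebra_simps)
  thus ?thesis using m by (simp add: field_simps)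
qed

text \<open>In the shortest-first schedule on \<open>m\<close> machines, a job of rank
  \<open>x\<close> contributes to \<open>x div m + 1\<close> completion times, its own included. So
  this is the cost of that schedule.\<close>

definition spt_cost :: "nat \<Rightarrow> job_instance \<Rightarrow> real" where
  "spt_cost m I = (\<Sum>j<num_jobs I. proc I j * load m (job_rank (proc I) {..<num_jobs I} j))"

text \<open>A rearrangement inequality. Abel summation reduces it to upper sets of
  \<open>proc I\<close>, on which the ranks are 0, 1, 2, ..., the smallest that distinct ones can
  be.\<close>

lemma spt_cost_le_inj:
  assumes "valid_instance I" "inj_on x {..<num_jobs I}"
  shows "spt_cost m I \<le> (\<Sum>j<num_jobs I. proc I j * load m (x j))"
  unfolding spt_cost_def
proof (rule sum_mult_le_of_upper_sets)
  show "0 \<le> proc I j" if "j \<in> {..<num_jobs I}" for j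
    using assms that by (auto simp: valid_instance_def less_imp_le)
  fix T assume T: "T \<subseteq> {..<num_jobs I}"
    and up: "\<And>i j. i \<in> T \<Longrightarrow> j \<in> {..<num_jobs I} \<Longrightarrow> proc I i \<le> proc I j \<Longrightarrow> j \<in> T"
  have "(\<Sum>j\<in>T. load m (job_rank (proc I) {..<num_jobs I} j)) = (\<Sum>k<card T. load m k)"
    by (rule sum_rank_upper_set) (use T up in auto)
  also have "\<dots> \<le> (\<Sum>j\<in>T. load m (x j))"
    by (rule sum_inj_ge)
      (use T assms finite_subset inj_on_subset in \<open>auto intro!: monoI load_mono\<close>)
  finally show "(\<Sum>j\<in>T. load m (job_rank (proc I) {..<num_jobs I} j)) \<le> (\<Sum>j\<in>T. load m (x j))" .
qed simp

text \<open>The best use of \<open>m\<close> machines is full rate on the \<open>m\<close> highest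
  ranks, where the window sum gives \<open>n\<close>. With at most \<open>m\<close> ranks every
  weight is 1.\<close>

lemma sum_rate_load_le:
  assumes m: "m \<ge> 1" and r: "\<And>x. x < n \<Longrightarrow> 0 \<le> r x \<and> r x \<le> 1" and sum: "(\<Sum>x<n. r x) \<le> real m"
  shows "(\<Sum>x<n. r x * load m x) \<le> real n"
proof (cases "n \<le> m")
  case True
  have "r x * load m x \<le> 1" if "x < n" for x
    using r[OF that] True that by (simp add: load_def)
  hence "(\<Sum>x<n. r x * load m x) \<le> (\<Sum>x<n. 1)" by (intro sum_mono) auto
  thus ?thesis by simp
next
  case False
  \<comment> \<open>\<open>w\<close> prices a unit of rate: beyond \<open>w * r x\<close>, only
    ranks in the last window can gain, and each at most \<open>load m x - w\<close>.\<close>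
  define w where "w = load m (n - m)"
  have w: "0 \<le> w" by (simp add: w_def load_nonneg)
  have "r x * load m x \<le> w * r x + (if n - m \<le> x then load m x - w else 0)" if "x < n" for x
  proof (cases "n - m \<le> x")
    case True
    hence "0 \<le> load m x - w" by (simp add: w_def load_mono)
    hence "r x * (load m x - w) \<le> 1 * (load m x - w)"
      using r[OF that] by (intro mult_right_mono) auto
    thus ?thesis using True by (simp add: algebra_simps)
  next
    case False
    hence "load m x \<le> w" by (simp add: w_def load_mono)
    hence "r x * load m x \<le> r x * w" using r[OF that] by (intro mult_left_mono) auto
    thus ?thesis using False by (simp add: mult.commute)
  qed
  hence "(\<Sum>x<n. r x * load m x) \<le> (\<Sum>x<n. w * r x + (if n - m \<le> x then load m x - w else 0))"
    by (intro sum_mono) auto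
  also have "\<dots> = w * (\<Sum>x<n. r x) + (\<Sum>x\<in>{n - m..<n}. load m x - w)"
  proof -
    have "(\<Sum>x<n. if n - m \<le> x then load m x - w else 0) = (\<Sum>x\<in>{n - m..<n}. load m x - w)"
      by (rule sum.mono_neutral_cong_right) auto
    thus ?thesis by (simp add: sum.distrib sum_distrib_left)
  qed
  also have "\<dots> \<le> w * real m + (\<Sum>x\<in>{n - m..<n}. load m x - w)"
    using sum w by (simp add: mult_left_mono)
  also have "\<dots> = (\<Sum>x\<in>{n - m..<n - m + m}. load m x)"
    using False by (simp add: sum_subtractf)
  also have "\<dots> = real n" using sum_load_window[OF m, of "n - m"] False by simp
  finally show ?thesis .
qed

text \<open>With ranks taken by \<open>t\<close>, the jobs with \<open>s \<le> t j\<close> form an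
  upper set, so their ranks are an initial segment and their weighted rates at time \<open>s\<close>
  sum to at most their number. Integrating bounds the weighted work by the sum of \<open>t\<close>.
  Allowing any such \<open>t\<close> spares a proof that the infimum in
  \<open>completion_time\<close> is attained.\<close>

lemma spt_cost_le_sum_completion:
  assumes I: "valid_instance I" and R: "feasible m I R" and m: "m \<ge> 1"
    and t: "\<And>j. j < num_jobs I \<Longrightarrow> 0 \<le> t j \<and> completed I R j (t j)"
  shows "spt_cost m I \<le> (\<Sum>j<num_jobs I. t j)"
proof -
  define n where "n = num_jobs I"
  define x where "x = job_rank t {..<n}"
  define T where "T = (\<Sum>j<n. t j)"
  have t0: "0 \<le> t j" and tT: "t j \<le> T" if "j < n" for j
    using t that unfolding T_def n_def by (auto intro!: member_le_sum[of j "{..<num_jobs I}" t])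
  \<comment> \<open>Cutting off at \<open>t j\<close> lets all integrals run over the common
    interval up to \<open>T\<close>.\<close>
  define f where "f j s = (if s \<in> {0..t j} then R j s else 0)" for j s
  define u where "u j s = (if s \<in> {0..t j} then 1 else 0 :: real)" for j s
  have f: "(f j has_integral elapsed R j (t j)) {0..T}" if "j < n" for j
    unfolding f_def elapsed_def
    by (subst has_integral_restrict)
      (use R t0 tT that in \<open>auto simp: feasible_def n_def intro!: integrable_integral\<close>)
  have u: "(u j has_integral t j) {0..T}" if "j < n" for j
    unfolding u_def
    by (subst has_integral_restrict)
      (use t0[OF that] tT[OF that] has_integral_const_real[of "1 :: real" 0 "t j"] in auto)
  have int: "(\<Sum>j<n. load m (x j) * elapsed R j (t j)) \<le> (\<Sum>j<n. t j)"
  proof (rule has_integral_le)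
    show "((\<lambda>s. \<Sum>j<n. load m (x j) * f j s) has_integral
            (\<Sum>j<n. load m (x j) * elapsed R j (t j))) {0..T}"
      using f by (intro has_integral_sum has_integral_mult_right) auto
    show "((\<lambda>s. \<Sum>j<n. u j s) has_integral (\<Sum>j<n. t j)) {0..T}"
      using u by (intro has_integral_sum) auto
    fix s assume s: "s \<in> {0..T}"
    define U where "U = {j \<in> {..<n}. s \<le> t j}"
    have U: "finite U" "U \<subseteq> {..<n}" by (auto simp: U_def)
    define r where "r k = R (inv_into U x k) s" for k
    have bij: "bij_betw x U {..<card U}"
    proof -
      have "x j = job_rank t U j" if "j \<in> U" for j
        unfolding x_def by (rule rank_upper_set) (use that in \<open>auto simp: U_def\<close>)
      thus ?thesis using bij_betw_rank[OF U(1), of t] by (simp cong: bij_betw_cong)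
    qed
    have r: "r (x j) = R j s" if "j \<in> U" for j
      using bij that by (simp add: r_def bij_betw_def)
    have rates: "0 \<le> R j s \<and> R j s \<le> 1" if "j < n" for j
      using R s that by (simp add: feasible_def n_def)
    have reindex: "(\<Sum>j\<in>U. g (x j)) = (\<Sum>k<card U. g k)" for g :: "nat \<Rightarrow> real"
      by (rule sum.reindex_bij_betw[OF bij])
    have "(\<Sum>j<n. load m (x j) * f j s) = (\<Sum>j\<in>U. r (x j) * load m (x j))"
      by (rule sum.mono_neutral_cong_right) (use s r in \<open>auto simp: U_def f_def\<close>)
    also have "\<dots> = (\<Sum>k<card U. r k * load m k)" by (rule reindex)
    also have "\<dots> \<le> real (card U)"
    proof (rule sum_rate_load_le[OF m])
      show "0 \<le> r k \<and> r k \<le> 1" if "k < card U" for k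
      proof -
        have "k \<in> x ` U" using bij that by (auto simp: bij_betw_def)
        thus ?thesis using r rates U by auto
      qed
      have "(\<Sum>k<card U. r k) = (\<Sum>j\<in>U. R j s)"
        using reindex[of r] r by simp
      also have "\<dots> \<le> (\<Sum>j<n. R j s)"
        by (rule sum_mono2) (use U rates in auto)
      also have "\<dots> \<le> real m" using R s by (simp add: feasible_def n_def)
      finally show "(\<Sum>k<card U. r k) \<le> real m" .
    qed
    also have "real (card U) = (\<Sum>j<n. u j s)"
    proof -
      have "(\<Sum>j<n. u j s) = (\<Sum>j\<in>U. 1)"
        by (rule sum.mono_neutral_cong_right) (use s in \<open>auto simp: U_def u_def\<close>)
      thus ?thesis by simp
    qed
    finally show "(\<Sum>j<n. load m (x j) * f j s) \<le> (\<Sum>j<n. u j s)" .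
  qed
  have "spt_cost m I \<le> (\<Sum>j<n. proc I j * load m (x j))"
    unfolding n_def
    by (rule spt_cost_le_inj[OF I])
      (use bij_betw_rank[of "{..<n}" t] in \<open>auto simp: x_def n_def bij_betw_def\<close>)
  also have "\<dots> \<le> (\<Sum>j<n. load m (x j) * elapsed R j (t j))"
    using t load_nonneg[of m]
    by (intro sum_mono, subst mult.commute, intro mult_left_mono)
      (auto simp: n_def completed_def)
  finally show ?thesis using int by (simp add: n_def)
qed

lemma spt_cost_le_opt:
  assumes I: "valid_instance I" and m: "m \<ge> 1"
  shows "ereal (spt_cost m I) \<le> opt m I"
  unfolding opt_def
proof (rule INF_greatest)
  fix R assume "R \<in> {R. feasible m I R}"
  hence R: "feasible m I R" by simp
  define n where "n = num_jobs I"
  define D where "D j = {t. 0 \<le> t \<and> completed I R j t}" for j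
  have C_ge: "0 \<le> completion_time I R j" for j
    unfolding completion_time_def by (rule INF_greatest) simp
  show "ereal (spt_cost m I) \<le> total_completion_time I R"
  proof (cases "\<exists>j<n. D j = {}")
    case True
    then obtain j where j: "j < n" "D j = {}" by auto
    hence "completion_time I R j = \<infinity>"
      unfolding completion_time_def D_def[symmetric] by (simp add: top_ereal_def)
    hence "total_completion_time I R = \<infinity>"
      using j C_ge unfolding total_completion_time_def n_def
      by (subst sum_Pinfty) auto
    thus ?thesis by simp
  next
    case False
    define c where "c j = Inf (D j)" for j
    have bdd: "bdd_below (D j)" for j by (rule bdd_belowI[of _ 0]) (simp add: D_def)
    have C: "completion_time I R j = ereal (c j)" if j: "j < n" for j
    proof -
      have "\<bar>INF t\<in>D j. ereal t\<bar> \<noteq> \<infinity>"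
      proof -
        obtain t where "t \<in> D j" using False j by blast
        hence "(INF t\<in>D j. ereal t) \<le> ereal t" by (rule INF_lower)
        moreover have "0 \<le> (INF t\<in>D j. ereal t)" by (rule INF_greatest) (simp add: D_def)
        ultimately show ?thesis by auto
      qed
      thus ?thesis
        unfolding completion_time_def c_def D_def[symmetric] by (rule ereal_Inf[symmetric])
    qed
    have "spt_cost m I \<le> (\<Sum>j<n. c j)"
    proof (rule field_le_epsilon)
      fix e :: real assume e: "e > 0"
      \<comment> \<open>The \<open>n\<close> errors \<open>d\<close> add up to at most
        \<open>e\<close>; the summand 1 covers \<open>n = 0\<close>.\<close>
      define d where "d = e / (real n + 1)"
      have d: "d > 0" using e by (simp add: d_def)
      have "\<exists>t. t \<in> D j \<and> t < c j + d" if "j < n" for j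
        using cInf_lessD[of "D j" "c j + d"] False that d by (auto simp: c_def)
      then obtain t where t: "\<And>j. j < n \<Longrightarrow> t j \<in> D j \<and> t j < c j + d" by metis
      have "spt_cost m I \<le> (\<Sum>j<n. t j)"
        unfolding n_def
        by (rule spt_cost_le_sum_completion[OF I R m]) (use t in \<open>auto simp: n_def D_def\<close>)
      also have "\<dots> \<le> (\<Sum>j<n. c j + d)" using t by (intro sum_mono) (auto simp: less_imp_le)
      also have "\<dots> = (\<Sum>j<n. c j) + real n * d" by (simp add: sum.distrib)
      also have "real n * d \<le> e" using e by (simp add: d_def field_simps)
      finally show "spt_cost m I \<le> (\<Sum>j<n. c j) + e" by simp
    qed
    thus ?thesis using C by (simp add: total_completion_time_def n_def)
  qed
qed

subsection \<open>Rates\<close>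

definition signal_level :: "job_instance \<Rightarrow> nat \<Rightarrow> real" where
  "signal_level I j = sig_frac I j * proc I j"

definition unfinished :: "job_instance \<Rightarrow> (nat \<Rightarrow> real) \<Rightarrow> nat set" where
  "unfinished I e = {j. j < num_jobs I \<and> e j < proc I j}"

definition promoted :: "real \<Rightarrow> job_instance \<Rightarrow> (nat \<Rightarrow> real) \<Rightarrow> nat set" where
  "promoted \<alpha> I e =
     {j \<in> unfinished I e. signal_level I j \<le> e j \<and> e j < signal_level I j / \<alpha>}"

text \<open>Signal levels matter only for jobs whose signal has been emitted, which keeps the rule
  non-clairvoyant. \<open>max 0\<close> covers more than \<open>m\<close> promoted jobs; the
  unpromoted ones then stand still.\<close>

definition rate :: "real \<Rightarrow> nat \<Rightarrow> job_instance \<Rightarrow> (nat \<Rightarrow> real) \<Rightarrow> nat \<Rightarrow> real" where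
  "rate \<alpha> m I e j =
     (if j \<in> promoted \<alpha> I e then
        if card {i \<in> promoted \<alpha> I e. lex_less (signal_level I) i j} < m then 1 else 0
      else if j \<in> unfinished I e then
        max 0 (min 1 ((real m - real (card (promoted \<alpha> I e)))
                        / real (card (unfinished I e - promoted \<alpha> I e))))
      else 0)"

lemma finite_unfinished [simp]: "finite (unfinished I e)"
  by (simp add: unfinished_def)

lemma promoted_subset: "promoted \<alpha> I e \<subseteq> unfinished I e"
  by (auto simp: promoted_def)

lemma finite_promoted [simp]: "finite (promoted \<alpha> I e)"
  by (rule finite_subset[OF promoted_subset]) simp

lemma card_unfinished:
  "card (unfinished I e)
     = card (promoted \<alpha> I e) + card (unfinished I e - promoted \<alpha> I e)"
  using card_Diff_subset[of "promoted \<alpha> I e" "unfinished I e"]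
    card_mono[of "unfinished I e" "promoted \<alpha> I e"] promoted_subset[of \<alpha> I e] by simp

lemma rate_nonneg: "0 \<le> rate \<alpha> m I e j"
  by (simp add: rate_def)

lemma rate_le_1: "rate \<alpha> m I e j \<le> 1"
  by (simp add: rate_def)

lemma rate_finished: "j \<notin> unfinished I e \<Longrightarrow> rate \<alpha> m I e j = 0"
  using promoted_subset by (auto simp: rate_def)

lemma sum_rate_unfinished:
  "(\<Sum>j<num_jobs I. rate \<alpha> m I e j) = (\<Sum>j\<in>unfinished I e. rate \<alpha> m I e j)"
  by (rule sum.mono_neutral_right) (auto simp: unfinished_def intro!: rate_finished)

lemma sum_rate:
  assumes "m \<ge> 1"
  shows "(\<Sum>j<num_jobs I. rate \<alpha> m I e j) = real (min (card (unfinished I e)) m)"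
proof -
  define U where "U = unfinished I e"
  define P where "P = promoted \<alpha> I e"
  define k where "k = card P"
  define u where "u = card (U - P)"
  have fin: "finite U" "finite P" "P \<subseteq> U"
    using promoted_subset by (auto simp: U_def P_def)
  \<comment> \<open>Ranks count from the top, so the first \<open>m\<close> promoted jobs by signal
    level hold the ranks from \<open>k - m\<close> to \<open>k - 1\<close>.\<close>
  have P: "rate \<alpha> m I e j = (if k \<le> job_rank (signal_level I) P j + m then 1 else 0)" if "j \<in> P" for j
  proof -
    have "card {i \<in> P. lex_less (signal_level I) i j} < m
        \<longleftrightarrow> k \<le> job_rank (signal_level I) P j + m"
      using card_lex_predecessors[OF fin(2) that, of "signal_level I"] by (auto simp: k_def)
    thus ?thesis using that by (simp add: rate_def P_def)
  qed
  have "(\<Sum>j\<in>P. rate \<alpha> m I e j)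
      = (\<Sum>j\<in>P. (\<lambda>x. if k \<le> x + m then 1 else 0) (job_rank (signal_level I) P j))"
    using P by (intro sum.cong) auto
  also have "\<dots> = (\<Sum>x<k. if k \<le> x + m then 1 else 0)"
    unfolding k_def by (rule sum_rank[OF fin(2)])
  also have "\<dots> = (\<Sum>x\<in>{k - m..<k}. 1)"
    by (rule sum.mono_neutral_cong_right) auto
  finally have sum_P: "(\<Sum>j\<in>P. rate \<alpha> m I e j) = real (min k m)" by simp
  have "(\<Sum>j\<in>U - P. rate \<alpha> m I e j) = real u * max 0 (min 1 ((real m - real k) / real u))"
    by (simp add: rate_def U_def P_def k_def u_def)
  also have "\<dots> = max 0 (min (real u) (real m - real k))"
    by (cases "u = 0") (auto simp: max_def min_def field_simps)
  finally have "(\<Sum>j\<in>U. rate \<alpha> m I e j) = real (min k m) + max 0 (min (real u) (real m - real k))"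
    using sum_P sum.subset_diff[OF fin(3,1), of "rate \<alpha> m I e"] by simp
  also have "\<dots> = real (min (k + u) m)" by (auto simp: max_def min_def)
  also have "k + u = card U"
    using card_unfinished[of I e \<alpha>] by (simp add: U_def P_def k_def u_def)
  finally show ?thesis by (simp add: sum_rate_unfinished U_def)
qed

lemma rate_eq_1:
  assumes "card (unfinished I e) \<le> m" "j \<in> unfinished I e"
  shows "rate \<alpha> m I e j = 1"
proof (cases "j \<in> promoted \<alpha> I e")
  case True
  have "card {i \<in> promoted \<alpha> I e. lex_less (signal_level I) i j} < card (promoted \<alpha> I e)"
    using card_lex_predecessors[OF finite_promoted True, of "signal_level I"] by simp
  thus ?thesis using True assms card_unfinished[of I e \<alpha>] by (simp add: rate_def)
next
  case False
  hence "0 < card (unfinished I e - promoted \<alpha> I e)"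
    using assms by (auto simp: card_gt_0_iff)
  thus ?thesis using False assms card_unfinished[of I e \<alpha>] by (simp add: rate_def field_simps)
qed

text \<open>A promoted job that waits has at least \<open>m\<close> promoted jobs before it, and
  then nothing is left for the unpromoted ones.\<close>

lemma rate_unpromoted_le:
  assumes "i \<notin> promoted \<alpha> I e" "j \<in> unfinished I e"
  shows "rate \<alpha> m I e i \<le> rate \<alpha> m I e j"
proof (cases "i \<in> unfinished I e \<and> j \<in> promoted \<alpha> I e \<and> rate \<alpha> m I e j \<noteq> 1")
  case True
  hence "m \<le> card {i \<in> promoted \<alpha> I e. lex_less (signal_level I) i j}"
    by (auto simp: rate_def split: if_splits)
  also have "\<dots> \<le> card (promoted \<alpha> I e)" by (rule card_mono) auto
  finally have "(real m - real (card (promoted \<alpha> I e)))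
      / real (card (unfinished I e - promoted \<alpha> I e)) \<le> 0"
    by (intro divide_nonpos_nonneg) auto
  hence "rate \<alpha> m I e i = 0"
    using assms by (simp add: rate_def)
  thus ?thesis using rate_nonneg by simp
next
  case False
  thus ?thesis
    using assms rate_le_1[of \<alpha> m I e i] rate_nonneg[of \<alpha> m I e j] rate_finished[of i I e \<alpha> m]
    by (auto simp: rate_def)
qed

lemma exists_rate_pos:
  assumes "m \<ge> 1" "unfinished I e \<noteq> {}"
  shows "\<exists>j\<in>unfinished I e. 0 < rate \<alpha> m I e j"
proof (rule ccontr)
  assume "\<not> ?thesis"
  hence "(\<Sum>j\<in>unfinished I e. rate \<alpha> m I e j) \<le> 0" by (intro sum_nonpos) auto
  moreover have "card (unfinished I e) > 0" using assms by (simp add: card_gt_0_iff)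
  ultimately show False
    using sum_rate[OF assms(1), of \<alpha> I e] assms by (simp add: sum_rate_unfinished)
qed

text \<open>With at most \<open>m\<close> unfinished jobs, \<open>j\<close> itself has full rate;
  otherwise all machines are busy.\<close>

lemma machines_le_weighted_rates:
  assumes "m \<ge> 1" "j \<in> unfinished I e"
  shows "real m \<le> real m * rate \<alpha> m I e j + (\<Sum>i\<in>{..<num_jobs I} - {j}. rate \<alpha> m I e i)"
proof (cases "card (unfinished I e) \<le> m")
  case True
  thus ?thesis using rate_eq_1[OF _ assms(2)] by (simp add: sum_nonneg rate_nonneg)
next
  case False
  have "j < num_jobs I" using assms by (simp add: unfinished_def)
  hence "rate \<alpha> m I e j + (\<Sum>i\<in>{..<num_jobs I} - {j}. rate \<alpha> m I e i) = real m"
    using sum_rate[OF assms(1), of \<alpha> I e] False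
    by (subst sum.remove[of _ j, symmetric]) auto
  moreover have "1 * rate \<alpha> m I e j \<le> real m * rate \<alpha> m I e j"
    using assms by (intro mult_right_mono rate_nonneg) auto
  ultimately show ?thesis by simp
qed

section \<open>Weighted rates for the consistency bound\<close>

lemma max_load_le:
  assumes "m \<ge> 1" "x < u"
  shows "real u * load m x \<le> 2 * (\<Sum>x<u. load m x)"
proof -
  have "load m x \<le> 1 + (real u - 1) / real m"
  proof -
    have "real (x div m) \<le> real x / real m" by (rule of_nat_div_le_of_nat)
    also have "\<dots> \<le> (real u - 1) / real m" using assms by (intro divide_right_mono) auto
    finally show ?thesis by (simp add: load_def)
  qed
  hence "real u * load m x \<le> real u * (1 + (real u - 1) / real m)" by (rule mult_left_mono) simp
  thus ?thesis using sum_load_ge[OF assms(1), of u] by linarith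
qed

text \<open>The \<open>u\<close> unpromoted jobs have the largest processing times, that is, the ranks below
  \<open>u\<close>. Their work is counted twice because the \<open>\<alpha>\<close>-fraction of the optimum pays for it again.\<close>

lemma card_le_weighted_rates:
  fixes \<rho> :: real
  assumes m: "m \<ge> 1" and u: "u \<le> n"
    and \<rho>: "\<rho> = max 0 (min 1 ((real m - real (n - u)) / real u))"
  shows "real n \<le> (\<Sum>x<n. (if u \<le> x then if n \<le> x + m then 1 else 0 else 2 * \<rho>) * load m x)"
    (is "_ \<le> (\<Sum>x<n. ?\<phi> x * load m x)")
proof -
  have \<rho>0: "0 \<le> \<rho>" by (simp add: \<rho>)
  consider "n \<le> m" | "m < n" "m \<le> n - u" | "m < n" "n - u < m" by linarith
  thus ?thesis
  proof cases
    case 1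
    have "1 \<le> ?\<phi> x * load m x" if "x < n" for x
    proof -
      have "\<rho> = 1" if "x < u"
      proof -
        have "real u \<le> real m - real (n - u)" using 1 u by (simp add: of_nat_diff)
        hence "1 \<le> (real m - real (n - u)) / real u" using that by simp
        thus ?thesis by (simp add: \<rho>)
      qed
      hence "1 \<le> ?\<phi> x" using 1 by auto
      thus ?thesis using mult_mono[of 1 "?\<phi> x" 1 "load m x"] load_ge_1[of m x] by simp
    qed
    hence "(\<Sum>x<n. 1) \<le> (\<Sum>x<n. ?\<phi> x * load m x)" by (intro sum_mono) auto
    thus ?thesis by simp
  next
    case 2
    have "real n = (\<Sum>x\<in>{n - m..<n}. load m x)"
      using sum_load_window[OF m, of "n - m"] 2 by simp
    also have "\<dots> = (\<Sum>x\<in>{n - m..<n}. ?\<phi> x * load m x)"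
      using 2 by (intro sum.cong) auto
    also have "\<dots> \<le> (\<Sum>x<n. ?\<phi> x * load m x)"
      by (rule sum_mono2) (use \<rho>0 load_nonneg in \<open>auto intro!: mult_nonneg_nonneg\<close>)
    finally show ?thesis .
  next
    case 3
    hence u0: "u > 0" and nm: "n - m < u" by linarith+
    \<comment> \<open>The machines left to the unpromoted jobs are as many as the ranks below
      \<open>u\<close> in the window of the last \<open>m\<close> ranks.\<close>
    have \<rho>u: "\<rho> * real u = real (u - (n - m))"
    proof -
      have "real m - real (n - u) = real (u - (n - m))" using 3 u by (auto simp: of_nat_diff)
      moreover have "real (u - (n - m)) / real u \<le> 1" using u0 by simp
      ultimately have "\<rho> = real (u - (n - m)) / real u" unfolding \<rho> by simp
      thus ?thesis using u0 by simp
    qed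
    \<comment> \<open>Each of these weights is at most the largest one below \<open>u\<close>, hence
      at most twice the average there. This is the source of the factor 2.\<close>
    have "(\<Sum>x\<in>{n - m..<u}. load m x) \<le> (\<Sum>x\<in>{n - m..<u}. load m (u - 1))"
      by (intro sum_mono load_mono) auto
    also have "\<dots> = \<rho> * (real u * load m (u - 1))" using \<rho>u by (simp add: algebra_simps)
    also have "\<dots> \<le> \<rho> * (2 * (\<Sum>x<u. load m x))"
      using max_load_le[OF m, of "u - 1" u] u0 \<rho>0 by (intro mult_left_mono) auto
    finally have low: "(\<Sum>x\<in>{n - m..<u}. load m x) \<le> \<rho> * (2 * (\<Sum>x<u. load m x))" .
    have "real n = (\<Sum>x\<in>{n - m..<n}. load m x)"
      using sum_load_window[OF m, of "n - m"] 3 by simp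
    also have "\<dots> = (\<Sum>x\<in>{n - m..<u}. load m x) + (\<Sum>x\<in>{u..<n}. load m x)"
      using nm u by (intro sum.atLeastLessThan_concat[symmetric]) auto
    also have "\<dots> \<le> (\<Sum>x<u. ?\<phi> x * load m x) + (\<Sum>x\<in>{u..<n}. ?\<phi> x * load m x)"
    proof (rule add_mono)
      show "(\<Sum>x\<in>{n - m..<u}. load m x) \<le> (\<Sum>x<u. ?\<phi> x * load m x)"
        using low by (simp add: sum_distrib_left mult_ac)
      show "(\<Sum>x\<in>{u..<n}. load m x) \<le> (\<Sum>x\<in>{u..<n}. ?\<phi> x * load m x)"
        using 3 by (intro sum_mono) auto
    qed
    also have "\<dots> = (\<Sum>x<n. ?\<phi> x * load m x)"
      using u sum.atLeastLessThan_concat[of 0 u n "\<lambda>x. ?\<phi> x * load m x"]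
      by (simp add: lessThan_atLeast0)
    finally show ?thesis .
  qed
qed

text \<open>The two order hypotheses, which correct predictions guarantee, place the promoted jobs
  on the ranks from \<open>u\<close> upwards among the unfinished jobs. The bound is stated with
  ranks among all jobs: these are no smaller and do not change over time, so the bound can be summed
  over phases.\<close>

lemma card_unfinished_le_charge:
  assumes m: "m \<ge> 1"
    and before: "\<And>i j. i \<in> promoted \<alpha> I e \<Longrightarrow> j \<in> unfinished I e - promoted \<alpha> I e \<Longrightarrow>
                   lex_less (proc I) i j"
    and same_order: "\<And>i j. i \<in> promoted \<alpha> I e \<Longrightarrow> j \<in> promoted \<alpha> I e \<Longrightarrow>
                   lex_less (signal_level I) i j \<longleftrightarrow> lex_less (proc I) i j"
  shows "real (card (unfinished I e)) \<le>
    (\<Sum>j<num_jobs I. rate \<alpha> m I e j * load m (job_rank (proc I) {..<num_jobs I} j)) +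
    (\<Sum>j\<in>unfinished I e - promoted \<alpha> I e.
        rate \<alpha> m I e j * load m (job_rank (proc I) {..<num_jobs I} j))"
proof -
  define U where "U = unfinished I e"
  define P where "P = promoted \<alpha> I e"
  define n where "n = card U"
  define u where "u = card (U - P)"
  define y where "y = job_rank (proc I) {..<num_jobs I}"
  define z where "z = job_rank (proc I) U"
  define r where "r = rate \<alpha> m I e"
  define \<rho> where "\<rho> = max 0 (min 1 ((real m - real (n - u)) / real u))"
  define \<phi> where "\<phi> x = (if u \<le> x then if n \<le> x + m then 1 else 0 else 2 * \<rho>)" for x
  have fin: "finite U" "finite P" "P \<subseteq> U"
    using promoted_subset by (auto simp: U_def P_def)
  have card_P: "card P = n - u"
    using card_unfinished[of I e \<alpha>] by (simp add: n_def u_def U_def P_def)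
  have zy: "z j \<le> y j" for j
    unfolding z_def y_def by (rule rank_mono) (auto simp: U_def unfinished_def)
  have r_P: "r j = \<phi> (z j)" if j: "j \<in> P" for j
  proof -
    have "U - P \<subseteq> {i \<in> U. lex_less (proc I) j i}"
      using before that by (auto simp: U_def P_def)
    hence "u \<le> z j"
      unfolding u_def z_def job_rank_def using fin by (intro card_mono) auto
    \<comment> \<open>Every unfinished job before \<open>j\<close> is promoted, so the priority test
      becomes a condition on the rank \<open>z j\<close>.\<close>
    have "{i \<in> P. lex_less (signal_level I) i j} = {i \<in> U. lex_less (proc I) i j}"
      using before same_order j fin(3) by (fastforce simp: U_def P_def lex_less_def)
    hence "card {i \<in> P. lex_less (signal_level I) i j} < m \<longleftrightarrow> n \<le> z j + m"
      using card_lex_predecessors[of U j "proc I"] fin j by (auto simp: n_def z_def)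
    thus ?thesis using j \<open>u \<le> z j\<close> by (simp add: r_def rate_def \<phi>_def P_def)
  qed
  have r_V: "2 * r j = \<phi> (z j)" if j: "j \<in> U - P" for j
  proof -
    have "{i \<in> U. lex_less (proc I) j i} \<subset> U - P"
      using before j by (fastforce simp: U_def P_def lex_less_def)
    hence "z j < u"
      unfolding u_def z_def job_rank_def using fin by (intro psubset_card_mono) auto
    thus ?thesis
      using j card_P by (simp add: r_def rate_def \<phi>_def \<rho>_def P_def U_def u_def)
  qed
  have nonneg: "0 \<le> r j" for j by (simp add: r_def rate_nonneg)
  have load_le: "r j * load m (z j) \<le> r j * load m (y j)" for j
    by (intro mult_left_mono load_mono zy nonneg)
  have "real n \<le> (\<Sum>x<n. \<phi> x * load m x)"
    unfolding \<phi>_def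
    by (rule card_le_weighted_rates[OF m _ \<rho>_def]) (auto simp: n_def u_def fin intro!: card_mono)
  also have "\<dots> = (\<Sum>j\<in>U. \<phi> (z j) * load m (z j))"
    unfolding n_def z_def by (rule sum_rank[OF fin(1), symmetric])
  also have "\<dots> = (\<Sum>j\<in>U - P. 2 * r j * load m (z j)) + (\<Sum>j\<in>P. r j * load m (z j))"
    using r_P r_V by (simp add: sum.subset_diff[OF fin(3,1)])
  also have "\<dots> = (\<Sum>j\<in>U. r j * load m (z j)) + (\<Sum>j\<in>U - P. r j * load m (z j))"
    by (simp add: sum.subset_diff[OF fin(3,1)] sum_distrib_left mult_ac)
  also have "\<dots> \<le> (\<Sum>j\<in>U. r j * load m (y j)) + (\<Sum>j\<in>U - P. r j * load m (y j))"
    using load_le by (intro add_mono sum_mono) auto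
  also have "(\<Sum>j\<in>U. r j * load m (y j)) = (\<Sum>j<num_jobs I. r j * load m (y j))"
    by (rule sum.mono_neutral_left)
      (auto simp: U_def unfinished_def r_def intro!: rate_finished)
  finally show ?thesis by (simp add: n_def U_def P_def y_def r_def)
qed

subsection \<open>Event-driven runs\<close>

text \<open>The elapsed times at which rates can change: signal, end of promotion,
  completion.\<close>

definition thresholds :: "real \<Rightarrow> job_instance \<Rightarrow> nat \<Rightarrow> real set" where
  "thresholds \<alpha> I j = {signal_level I j, signal_level I j / \<alpha>, proc I j}"

definition pending :: "real \<Rightarrow> job_instance \<Rightarrow> (nat \<Rightarrow> real) \<Rightarrow> (nat \<times> real) set" where
  "pending \<alpha> I e = (SIGMA j:unfinished I e. {\<theta> \<in> thresholds \<alpha> I j. e j < \<theta>})"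

definition event_delays :: "real \<Rightarrow> nat \<Rightarrow> job_instance \<Rightarrow> (nat \<Rightarrow> real) \<Rightarrow> real set" where
  "event_delays \<alpha> m I e =
     {(\<theta> - e j) / rate \<alpha> m I e j | j \<theta>. (j, \<theta>) \<in> pending \<alpha> I e \<and> 0 < rate \<alpha> m I e j}"

text \<open>The value 1 after the last completion is arbitrary; it makes the event times unbounded.\<close>

definition delay :: "real \<Rightarrow> nat \<Rightarrow> job_instance \<Rightarrow> (nat \<Rightarrow> real) \<Rightarrow> real" where
  "delay \<alpha> m I e = (if unfinished I e = {} then 1 else Min (event_delays \<alpha> m I e))"

primrec state :: "real \<Rightarrow> nat \<Rightarrow> job_instance \<Rightarrow> nat \<Rightarrow> nat \<Rightarrow> real" where
  "state \<alpha> m I 0 = (\<lambda>j. 0)"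
| "state \<alpha> m I (Suc k) =
     (\<lambda>j. state \<alpha> m I k j
            + delay \<alpha> m I (state \<alpha> m I k) * rate \<alpha> m I (state \<alpha> m I k) j)"

definition clock :: "real \<Rightarrow> nat \<Rightarrow> job_instance \<Rightarrow> nat \<Rightarrow> real" where
  "clock \<alpha> m I k = (\<Sum>l<k. delay \<alpha> m I (state \<alpha> m I l))"

text \<open>Phases are half-open, so a new rate applies at the very moment of an event. The run is
  computed from the whole instance; that it depends only on observations is shown
  separately.\<close>

definition algorithm :: "real \<Rightarrow> nat \<Rightarrow> job_instance \<Rightarrow> schedule" where
  "algorithm \<alpha> m I j t =
     rate \<alpha> m I (state \<alpha> m I (LEAST k. t < clock \<alpha> m I (Suc k))) j"

lemma finite_pending [simp]: "finite (pending \<alpha> I e)"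
  by (auto simp: pending_def thresholds_def)

lemma finite_event_delays [simp]: "finite (event_delays \<alpha> m I e)"
proof -
  have "event_delays \<alpha> m I e \<subseteq> (\<lambda>(j, \<theta>). (\<theta> - e j) / rate \<alpha> m I e j) ` pending \<alpha> I e"
    by (force simp: event_delays_def)
  thus ?thesis by (rule finite_subset) simp
qed

lemma event_delays_pos: "d \<in> event_delays \<alpha> m I e \<Longrightarrow> 0 < d"
  by (auto simp: event_delays_def pending_def)

lemma event_delays_nonempty:
  assumes "m \<ge> 1" "unfinished I e \<noteq> {}"
  shows "event_delays \<alpha> m I e \<noteq> {}"
proof -
  obtain j where j: "j \<in> unfinished I e" "0 < rate \<alpha> m I e j"
    using exists_rate_pos[OF assms] by auto
  have "(j, proc I j) \<in> pending \<alpha> I e"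
    using j by (auto simp: pending_def thresholds_def unfinished_def)
  thus ?thesis using j by (auto simp: event_delays_def)
qed

lemma delay_pos:
  assumes "m \<ge> 1"
  shows "0 < delay \<alpha> m I e"
  using event_delays_nonempty[OF assms, of I e \<alpha>] event_delays_pos
  by (auto simp: delay_def Min_gr_iff)

lemma delay_event:
  assumes "m \<ge> 1" "unfinished I e \<noteq> {}"
  obtains j \<theta> where "(j, \<theta>) \<in> pending \<alpha> I e" "0 < rate \<alpha> m I e j"
    "e j + delay \<alpha> m I e * rate \<alpha> m I e j = \<theta>"
proof -
  have "delay \<alpha> m I e \<in> event_delays \<alpha> m I e"
    using Min_in[OF finite_event_delays event_delays_nonempty[OF assms]] assms
    by (simp add: delay_def)
  then obtain j \<theta> where "(j, \<theta>) \<in> pending \<alpha> I e" "0 < rate \<alpha> m I e j"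
    "delay \<alpha> m I e = (\<theta> - e j) / rate \<alpha> m I e j"
    by (auto simp: event_delays_def)
  thus ?thesis using that[of j \<theta>] by simp
qed

text \<open>By minimality of \<open>delay\<close>, no pending threshold is passed within a phase,
  and none is met before its end.\<close>

lemma below_threshold:
  assumes "(j, \<theta>) \<in> pending \<alpha> I e"
  shows "d \<le> delay \<alpha> m I e \<Longrightarrow> e j + d * rate \<alpha> m I e j \<le> \<theta>"
    and "d < delay \<alpha> m I e \<Longrightarrow> e j + d * rate \<alpha> m I e j < \<theta>"
proof -
  have lt: "e j < \<theta>" and U: "unfinished I e \<noteq> {}" using assms by (auto simp: pending_def)
  have *: "delay \<alpha> m I e \<le> (\<theta> - e j) / rate \<alpha> m I e j" if "0 < rate \<alpha> m I e j"
  proof -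
    have "(\<theta> - e j) / rate \<alpha> m I e j \<in> event_delays \<alpha> m I e"
      using that assms by (auto simp: event_delays_def)
    thus ?thesis using U by (simp add: delay_def)
  qed
  have full: "e j + delay \<alpha> m I e * rate \<alpha> m I e j \<le> \<theta>"
    using * lt rate_nonneg[of \<alpha> m I e j]
    by (cases "rate \<alpha> m I e j = 0") (auto simp: field_simps)
  show "e j + d * rate \<alpha> m I e j \<le> \<theta>" if "d \<le> delay \<alpha> m I e"
    using full mult_right_mono[OF that rate_nonneg[of \<alpha> m I e j]] by linarith
  show "e j + d * rate \<alpha> m I e j < \<theta>" if d: "d < delay \<alpha> m I e"
  proof (cases "rate \<alpha> m I e j = 0")
    case False
    hence "d * rate \<alpha> m I e j < delay \<alpha> m I e * rate \<alpha> m I e j"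
      using d rate_nonneg[of \<alpha> m I e j] by (intro mult_strict_right_mono) auto
    thus ?thesis using full by linarith
  qed (use lt in simp)
qed

section \<open>A single run: phases, elapsed times and domination\<close>

locale run =
  fixes \<alpha> :: real and m :: nat and I :: job_instance
  assumes alpha_pos: "0 < \<alpha>" and alpha_le_1: "\<alpha> \<le> 1" and machines: "m \<ge> 1"
    and valid: "valid_instance I"
begin

abbreviation "n \<equiv> num_jobs I"
abbreviation "E \<equiv> state \<alpha> m I"
abbreviation "\<tau> \<equiv> clock \<alpha> m I"
abbreviation "r k \<equiv> rate \<alpha> m I (E k)"
abbreviation "\<delta> k \<equiv> delay \<alpha> m I (E k)"
abbreviation "U k \<equiv> unfinished I (E k)"
abbreviation "P k \<equiv> promoted \<alpha> I (E k)"
abbreviation "A \<equiv> algorithm \<alpha> m I"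

lemma proc_pos: "j < n \<Longrightarrow> 0 < proc I j"
  using valid by (simp add: valid_instance_def)

lemma signal_level_nonneg: "j < n \<Longrightarrow> 0 \<le> signal_level I j"
  using valid by (simp add: valid_instance_def signal_level_def less_imp_le)

lemma signal_level_le: "j < n \<Longrightarrow> signal_level I j \<le> proc I j"
  using valid mult_right_mono[of "sig_frac I j" 1 "proc I j"]
  by (simp add: valid_instance_def signal_level_def less_imp_le)

lemma le_divide_alpha: "0 \<le> x \<Longrightarrow> x \<le> x / \<alpha>"
  using alpha_pos alpha_le_1 mult_right_le_one_le[of x \<alpha>] by (simp add: field_simps)

lemma delay_pos: "0 < \<delta> k"
  by (rule delay_pos[OF machines])

lemma gain_nonneg: "0 \<le> \<delta> k * r k j"
  using delay_pos[of k] by (simp add: rate_nonneg)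

lemma state_Suc_ge: "E k j \<le> E (Suc k) j"
  using gain_nonneg by simp

lemma state_mono: "k \<le> l \<Longrightarrow> E k j \<le> E l j"
  by (rule lift_Suc_mono_le[of "\<lambda>k. E k j"]) (rule state_Suc_ge)

lemma state_eq_sum: "E k j = (\<Sum>l<k. \<delta> l * r l j)"
  by (induction k) simp_all

lemma unfinished_antimono: "k \<le> l \<Longrightarrow> U l \<subseteq> U k"
  by (auto simp: unfinished_def intro: le_less_trans[OF state_mono])

lemma state_Suc_le:
  assumes "j \<in> U k" "\<theta> \<in> thresholds \<alpha> I j" "E k j < \<theta>"
  shows "E (Suc k) j \<le> \<theta>"
  using below_threshold(1)[of j \<theta> \<alpha> I "E k" "\<delta> k" m] assms by (auto simp: pending_def)

lemma state_Suc_finished: "j \<notin> U k \<Longrightarrow> E (Suc k) j = E k j"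
  by (simp add: rate_finished)

lemma state_le_proc:
  assumes "j < n"
  shows "E k j \<le> proc I j"
proof (induction k)
  case 0
  show ?case using proc_pos[OF assms] by simp
next
  case (Suc k)
  show ?case
  proof (cases "j \<in> U k")
    case True
    thus ?thesis
      by (intro state_Suc_le) (auto simp: thresholds_def unfinished_def)
  next
    case False
    thus ?thesis using Suc state_Suc_finished[OF False] by (simp del: state.simps)
  qed
qed

text \<open>Phases stop at thresholds, so the first state that reaches \<open>\<theta>\<close>
  equals it. The bound by \<open>proc I j\<close> keeps \<open>j\<close> unfinished until then. This
  locates a signal at an exact clock value.\<close>

lemma threshold_hit:
  assumes j: "j < n" and \<theta>: "\<theta> \<in> thresholds \<alpha> I j" "0 \<le> \<theta>" "\<theta> \<le> proc I j"
    and "\<theta> \<le> E k j"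
  obtains i where "i \<le> k" "E i j = \<theta>"
proof -
  define i where "i = (LEAST i. \<theta> \<le> E i j)"
  have hit: "\<theta> \<le> E i j" unfolding i_def by (rule LeastI[of _ k]) (use assms in simp)
  have "i \<le> k" unfolding i_def by (rule Least_le) (use assms in simp)
  moreover have "E i j \<le> \<theta>"
  proof (cases i)
    case 0
    thus ?thesis using \<theta> by simp
  next
    case (Suc l)
    hence "E l j < \<theta>" using not_less_Least[of l "\<lambda>i. \<theta> \<le> E i j"] by (simp add: i_def)
    thus ?thesis
      unfolding Suc by (intro state_Suc_le) (use j \<theta> in \<open>auto simp: unfinished_def\<close>)
  qed
  ultimately show thesis using hit that[of i] by simp
qed

text \<open>The termination measure: the event ending the phase is struck off, and growing elapsed
  times add no new pending thresholds.\<close>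

lemma pending_decreases:
  assumes "U k \<noteq> {}"
  shows "card (pending \<alpha> I (E (Suc k))) < card (pending \<alpha> I (E k))"
proof (rule psubset_card_mono[OF finite_pending])
  obtain j \<theta> where *: "(j, \<theta>) \<in> pending \<alpha> I (E k)" "E (Suc k) j = \<theta>"
    using delay_event[OF machines assms, of \<alpha>] by (metis state.simps(2))
  have "pending \<alpha> I (E (Suc k)) \<subseteq> pending \<alpha> I (E k)"
    using unfinished_antimono[of k "Suc k"]
    by (auto simp: pending_def simp del: state.simps intro: le_less_trans[OF state_Suc_ge])
  moreover have "(j, \<theta>) \<notin> pending \<alpha> I (E (Suc k))" using * by (simp add: pending_def)
  ultimately show "pending \<alpha> I (E (Suc k)) \<subset> pending \<alpha> I (E k)" using * by auto
qed

lemma all_finish: "\<exists>K. U K = {}"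
proof (rule ccontr)
  assume *: "\<nexists>K. U K = {}"
  have "card (pending \<alpha> I (E k)) + k \<le> card (pending \<alpha> I (E 0))" for k
  proof (induction k)
    case (Suc k)
    thus ?case using pending_decreases[of k] * by fastforce
  qed simp
  from this[of "Suc (card (pending \<alpha> I (E 0)))"] show False by simp
qed

lemma clock_0 [simp]: "\<tau> 0 = 0"
  by (simp add: clock_def)

lemma clock_Suc: "\<tau> (Suc k) = \<tau> k + \<delta> k"
  by (simp add: clock_def)

lemma clock_mono: "k \<le> l \<Longrightarrow> \<tau> k \<le> \<tau> l"
  by (rule lift_Suc_mono_le[of \<tau>]) (use delay_pos in \<open>simp_all add: clock_Suc less_imp_le\<close>)

lemma clock_nonneg: "0 \<le> \<tau> k"
  using clock_mono[of 0 k] by simp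

lemma clock_unbounded: "\<exists>k. t < \<tau> k"
proof -
  obtain K where K: "U K = {}" using all_finish by auto
  have late: "U l = {}" if "K \<le> l" for l using unfinished_antimono[OF that] K by simp
  have "\<tau> (K + l) = \<tau> K + real l" for l
    by (induction l) (simp_all add: clock_Suc delay_def late)
  moreover obtain l where "t < real l" using reals_Archimedean2 by blast
  ultimately have "t < \<tau> (K + l)" using clock_nonneg[of K] by simp
  thus ?thesis by blast
qed

lemma obtain_phase:
  assumes "0 \<le> t"
  obtains k where "\<tau> k \<le> t" "t < \<tau> (Suc k)"
proof -
  define k where "k = (LEAST k. t < \<tau> (Suc k))"
  have "\<exists>k. t < \<tau> (Suc k)"
    using clock_unbounded[of t] clock_mono by (meson le_SucI le_refl less_le_trans)
  hence "t < \<tau> (Suc k)" unfolding k_def by (rule LeastI_ex)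
  moreover have "\<tau> k \<le> t"
  proof (cases k)
    case (Suc l)
    thus ?thesis using not_less_Least[of l "\<lambda>k. t < \<tau> (Suc k)"] by (simp add: k_def)
  qed (use assms in simp)
  ultimately show thesis using that by blast
qed

lemma algorithm_phase:
  assumes "\<tau> k \<le> t" "t < \<tau> (Suc k)"
  shows "A j t = r k j"
proof -
  have "(LEAST k. t < \<tau> (Suc k)) = k"
  proof (rule Least_equality)
    fix l assume l: "t < \<tau> (Suc l)"
    show "k \<le> l"
    proof (rule ccontr)
      assume "\<not> k \<le> l"
      hence "\<tau> (Suc l) \<le> \<tau> k" by (intro clock_mono) simp
      thus False using l assms by simp
    qed
  qed fact
  thus ?thesis by (simp add: algorithm_def)
qed

lemma has_integral_phase:
  assumes "\<tau> k \<le> t" "t \<le> \<tau> (Suc k)"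
  shows "(A j has_integral (t - \<tau> k) * r k j) {\<tau> k..t}"
\<comment> \<open>At \<open>t = \<tau> (Suc k)\<close> the rate of the next phase applies already; a
  single point does not affect the integral.\<close>
proof (rule has_integral_spike_finite[of "{t}"])
  show "A j s = r k j" if "s \<in> {\<tau> k..t} - {t}" for s
    using that assms by (intro algorithm_phase) auto
  show "((\<lambda>s. r k j) has_integral (t - \<tau> k) * r k j) {\<tau> k..t}"
    using assms has_integral_const_real[of "r k j" "\<tau> k" t] by simp
qed simp

lemma has_integral_clock: "(A j has_integral E k j) {0..\<tau> k}"
proof (induction k)
  case (Suc k)
  have "\<tau> k \<le> \<tau> (Suc k)" by (rule clock_mono) simp
  from has_integral_combine[OF clock_nonneg this Suc has_integral_phase[OF this order_refl]]
  show ?case by (simp add: clock_Suc)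
qed (use has_integral_refl(2)[of "A j" 0] in simp)

lemma has_integral_algorithm:
  assumes "\<tau> k \<le> t" "t \<le> \<tau> (Suc k)"
  shows "(A j has_integral E k j + (t - \<tau> k) * r k j) {0..t}"
  by (rule has_integral_combine[OF clock_nonneg assms(1) has_integral_clock
        has_integral_phase[OF assms]])

lemma elapsed_phase:
  assumes "\<tau> k \<le> t" "t \<le> \<tau> (Suc k)"
  shows "elapsed A j t = E k j + (t - \<tau> k) * r k j"
  unfolding elapsed_def by (rule integral_unique[OF has_integral_algorithm[OF assms]])

lemma elapsed_clock: "elapsed A j (\<tau> k) = E k j"
  using elapsed_phase[of k "\<tau> k"] clock_mono[of k "Suc k"] by simp

lemma completed_phase:
  assumes "\<tau> k \<le> t" "t < \<tau> (Suc k)" "j < n"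
  shows "completed I A j t \<longleftrightarrow> j \<notin> U k"
proof (cases "j \<in> U k")
  case True
  hence "(j, proc I j) \<in> pending \<alpha> I (E k)"
    by (auto simp: pending_def thresholds_def unfinished_def)
  hence "E k j + (t - \<tau> k) * r k j < proc I j"
    using assms by (intro below_threshold(2)) (auto simp: clock_Suc)
  thus ?thesis using True assms by (simp add: completed_def elapsed_phase)
next
  case False
  thus ?thesis
    using assms by (simp add: completed_def elapsed_phase rate_finished)
      (simp add: unfinished_def)
qed

lemma feasible: "feasible m I A"
  unfolding feasible_def
proof (intro conjI allI impI)
  fix t :: real assume "0 \<le> t"
  then obtain k where k: "\<tau> k \<le> t" "t < \<tau> (Suc k)" by (rule obtain_phase)
  show "(\<Sum>j<n. A j t) \<le> real m"
    using sum_rate[OF machines, of \<alpha> I "E k"] by (simp add: algorithm_phase[OF k])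
  fix j assume j: "j < n"
  show "A j integrable_on {0..t}"
    using has_integral_algorithm[of k t] k by (auto simp: integrable_on_def)
  show "0 \<le> A j t" "A j t \<le> 1"
    by (simp_all add: algorithm_phase[OF k] rate_nonneg rate_le_1)
  show "A j t = 0" if "completed I A j t"
    using that by (simp add: algorithm_phase[OF k] completed_phase[OF k j] rate_finished)
qed

definition finish :: "nat \<Rightarrow> nat" where
  "finish j = (LEAST k. j \<notin> U k)"

lemma finished_at_finish: "j \<notin> U (finish j)"
  unfolding finish_def by (rule LeastI_ex) (use all_finish in blast)

lemma unfinished_iff: "j \<in> U k \<longleftrightarrow> k < finish j"
  using finished_at_finish[of j] unfinished_antimono[of "finish j" k]
    not_less_Least[of k "\<lambda>k. j \<notin> U k"]
  by (auto simp: finish_def[symmetric] not_less[symmetric])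

lemma completion_time_le:
  assumes "j < n"
  shows "completion_time I A j \<le> ereal (\<tau> (finish j))"
  unfolding completion_time_def
proof (rule INF_lower)
  show "\<tau> (finish j) \<in> {t. 0 \<le> t \<and> completed I A j t}"
    using finished_at_finish[of j] assms clock_nonneg
    by (auto simp: completed_def elapsed_clock unfinished_def not_less)
qed

lemma total_completion_time_le:
  "total_completion_time I A \<le> ereal (\<Sum>j<n. \<tau> (finish j))"
  using sum_mono[of "{..<n}" "completion_time I A" "\<lambda>j. ereal (\<tau> (finish j))"]
  by (simp add: total_completion_time_def completion_time_le)

text \<open>Both invariants need a joint induction. An unpromoted \<open>i\<close> gains no more
  than \<open>j\<close>. A promoted \<open>i\<close> stays within
  \<open>signal_level I i / \<alpha>\<close>, and the second invariant says that \<open>j\<close>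
  has already received \<open>signal_level I i\<close>. The first invariant serves robustness, the
  second consistency.\<close>

lemma unfinished_dominates:
  assumes "\<And>l. l < k \<Longrightarrow> j \<in> U l"
  shows "E k i \<le> E k j / \<alpha> \<and> min (E k i) (signal_level I i) \<le> E k j"
  using assms
proof (induction k)
  case (Suc k)
  hence IH: "E k i \<le> E k j / \<alpha>" "min (E k i) (signal_level I i) \<le> E k j" by auto
  have mono: "E k j \<le> E (Suc k) j" by (rule state_Suc_ge)
  show ?case
  proof (cases "i \<in> P k")
    case True
    hence i: "signal_level I i \<le> E k i" "E k i < signal_level I i / \<alpha>" "i \<in> U k"
      by (auto simp: promoted_def)
    have "E (Suc k) i \<le> signal_level I i / \<alpha>"
      by (rule state_Suc_le) (use i in \<open>auto simp: thresholds_def\<close>)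
    moreover have "signal_level I i \<le> E (Suc k) j" using IH(2) i mono by linarith
    ultimately show ?thesis
      using alpha_pos by (auto simp del: state.simps simp: field_simps min_le_iff_disj)
  next
    case False
    define d where "d = \<delta> k * r k i"
    have "d \<le> \<delta> k * r k j"
      unfolding d_def
      using False Suc.prems[of k] delay_pos[of k]
      by (intro mult_left_mono rate_unpromoted_le) auto
    hence j: "E k j + d \<le> E (Suc k) j" and i: "E (Suc k) i = E k i + d"
      by (simp_all add: d_def)
    have d: "0 \<le> d" unfolding d_def by (rule gain_nonneg)
    have "E k i + d \<le> E k j / \<alpha> + d / \<alpha>" using IH(1) le_divide_alpha[OF d] by linarith
    also have "\<dots> \<le> E (Suc k) j / \<alpha>"
      using j alpha_pos by (simp add: divide_right_mono flip: add_divide_distrib del: state.simps)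
    finally show ?thesis using i j IH(2) d by linarith
  qed
qed simp

lemma state_finish_le: "E (finish j) i \<le> proc I j / \<alpha>" if "j < n"
proof -
  have "E (finish j) i \<le> E (finish j) j / \<alpha>"
    using unfinished_dominates[of "finish j" j i] by (simp add: unfinished_iff)
  also have "\<dots> \<le> proc I j / \<alpha>"
    using state_le_proc[OF that] alpha_pos by (intro divide_right_mono) auto
  finally show ?thesis .
qed

end

subsection \<open>Competitive ratios and non-clairvoyance\<close>

text \<open>Collects the two mutual delays of each pair at the job that comes first in the
  order.\<close>

lemma sum_pairs:
  fixes D :: "nat \<Rightarrow> nat \<Rightarrow> real"
  assumes "finite S"
  shows "(\<Sum>j\<in>S. \<Sum>i\<in>S - {j}. D i j)
    = (\<Sum>j\<in>S. \<Sum>i\<in>{i \<in> S. lex_less f j i}. D i j + D j i)"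
proof -
  have "(\<Sum>i\<in>S - {j}. D i j)
      = (\<Sum>i\<in>{i \<in> S. lex_less f j i}. D i j) + (\<Sum>i\<in>{i \<in> S. lex_less f i j}. D i j)"
    if "j \<in> S" for j
  proof -
    have "S - {j} = {i \<in> S. lex_less f j i} \<union> {i \<in> S. lex_less f i j}"
      by (auto simp: lex_less_def)
    hence "(\<Sum>i\<in>S - {j}. D i j)
        = (\<Sum>i\<in>{i \<in> S. lex_less f j i} \<union> {i \<in> S. lex_less f i j}. D i j)" by simp
    thus ?thesis
      by (subst (asm) sum.union_disjoint) (use assms in \<open>auto simp: lex_less_def\<close>)
  qed
  moreover have "(\<Sum>j\<in>S. \<Sum>i\<in>{i \<in> S. lex_less f i j}. D i j)
      = (\<Sum>j\<in>S. \<Sum>i\<in>{i \<in> S. lex_less f j i}. D j i)"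
    by (rule sum.swap_restrict[OF assms assms])
  ultimately show ?thesis by (simp add: sum.distrib)
qed

text \<open>On an upper set of size \<open>Y\<close> the left coefficients sum to
  \<open>Y + c * Y * (Y - 1) / (2 * m)\<close>. As \<open>2 \<le> c\<close>, the first term is at
  most \<open>c * Y / 2\<close>, and \<open>sum_load_ge\<close> applies.\<close>

lemma sum_pairs_le_spt_cost:
  assumes I: "valid_instance I" and m: "m \<ge> 1" and c: "2 \<le> c"
  shows "(\<Sum>j<num_jobs I. proc I j *
            (1 + c / real m * real (job_rank (proc I) {..<num_jobs I} j))) \<le> c * spt_cost m I"
proof -
  define S where "S = {..<num_jobs I}"
  define z where "z = job_rank (proc I) S"
  have "(\<Sum>j\<in>S. proc I j * (1 + c / real m * real (z j)))
      \<le> (\<Sum>j\<in>S. proc I j * (c * load m (z j)))"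
  proof (rule sum_mult_le_of_upper_sets)
    show "0 \<le> proc I j" if "j \<in> S" for j
      using I that by (simp add: valid_instance_def S_def less_imp_le)
    fix T assume T: "T \<subseteq> S"
      and up: "\<And>i j. i \<in> T \<Longrightarrow> j \<in> S \<Longrightarrow> proc I i \<le> proc I j \<Longrightarrow> j \<in> T"
    have ranks: "(\<Sum>j\<in>T. g (z j)) = (\<Sum>x<card T. g x)" for g :: "nat \<Rightarrow> real"
      unfolding z_def by (rule sum_rank_upper_set) (use T up in \<open>auto simp: S_def\<close>)
    define Y where "Y = real (card T)"
    have triangle: "2 * (\<Sum>x<k. real x) = real k * (real k - 1)" for k :: nat
      by (induction k) (simp_all add: algebra_simps)
    have "2 * (\<Sum>x<card T. 1 + c / real m * real x)
        = 2 * Y + c / real m * (2 * (\<Sum>x<card T. real x))"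
      by (simp add: Y_def sum.distrib sum_distrib_left mult_ac)
    also have "2 * (\<Sum>x<card T. real x) = Y * (Y - 1)" unfolding Y_def by (rule triangle)
    also have "2 * Y + c / real m * (Y * (Y - 1)) \<le> c * Y + c / real m * (Y * (Y - 1))"
      using c by (simp add: Y_def mult_right_mono)
    also have "\<dots> = c * (Y * (1 + (Y - 1) / real m))"
      by (simp add: algebra_simps add_divide_distrib diff_divide_distrib)
    also have "\<dots> \<le> c * (2 * (\<Sum>x<card T. load m x))"
      unfolding Y_def using c by (intro mult_left_mono sum_load_ge m) auto
    finally have "(\<Sum>x<card T. 1 + c / real m * real x) \<le> c * (\<Sum>x<card T. load m x)"
      by linarith
    hence "(\<Sum>x<card T. 1 + c / real m * real x) \<le> (\<Sum>x<card T. c * load m x)"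
      unfolding sum_distrib_left .
    thus "(\<Sum>j\<in>T. 1 + c / real m * real (z j)) \<le> (\<Sum>j\<in>T. c * load m (z j))"
      using ranks[of "\<lambda>x. 1 + c / real m * real x"] ranks[of "\<lambda>x. c * load m x"] by simp
  qed (simp add: S_def)
  also have "\<dots> = c * spt_cost m I"
    by (simp add: spt_cost_def S_def z_def sum_distrib_left mult_ac)
  finally show ?thesis by (simp add: S_def z_def)
qed

section \<open>Robustness and consistency of a run\<close>

context run
begin

text \<open>\<open>machines_le_weighted_rates\<close>, summed over the phases before
  \<open>j\<close> finishes.\<close>

lemma machines_finish_le:
  assumes j: "j < n"
  shows "real m * \<tau> (finish j)
      \<le> real m * proc I j + (\<Sum>i\<in>{..<n} - {j}. E (finish j) i)"
proof -
  have "real m * \<tau> (finish j) = (\<Sum>l<finish j. \<delta> l * real m)"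
    by (simp add: clock_def sum_distrib_left mult.commute)
  also have "\<dots> \<le> (\<Sum>l<finish j. \<delta> l * (real m * r l j + (\<Sum>i\<in>{..<n} - {j}. r l i)))"
    using delay_pos by (intro sum_mono mult_left_mono machines_le_weighted_rates[OF machines])
      (auto simp: unfinished_iff less_imp_le)
  also have "\<dots> = real m * (\<Sum>l<finish j. \<delta> l * r l j)
      + (\<Sum>l<finish j. \<Sum>i\<in>{..<n} - {j}. \<delta> l * r l i)"
    by (simp add: distrib_left sum.distrib sum_distrib_left mult_ac)
  also have "(\<Sum>l<finish j. \<Sum>i\<in>{..<n} - {j}. \<delta> l * r l i) = (\<Sum>i\<in>{..<n} - {j}. E (finish j) i)"
    by (subst sum.swap) (simp flip: state_eq_sum)
  also have "(\<Sum>l<finish j. \<delta> l * r l j) = E (finish j) j" by (simp flip: state_eq_sum)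
  also have "real m * E (finish j) j \<le> real m * proc I j"
    using state_le_proc[OF j] by (simp add: mult_left_mono)
  finally show ?thesis by simp
qed

lemma robust_bound: "(\<Sum>j<n. \<tau> (finish j)) \<le> (1 + 1 / \<alpha>) * spt_cost m I"
proof -
  define c where "c = 1 + 1 / \<alpha>"
  define z where "z = job_rank (proc I) {..<n}"
  have m: "real m > 0" using machines by simp
  have "real m * (\<Sum>j<n. \<tau> (finish j))
      \<le> (\<Sum>j<n. real m * proc I j + (\<Sum>i\<in>{..<n} - {j}. E (finish j) i))"
    unfolding sum_distrib_left by (intro sum_mono machines_finish_le) simp
  also have "\<dots> = (\<Sum>j<n. real m * proc I j)
      + (\<Sum>j<n. \<Sum>i\<in>{i \<in> {..<n}. lex_less (proc I) j i}. E (finish j) i + E (finish i) j)"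
    by (simp add: sum.distrib sum_pairs[of _ _ "proc I"])
  \<comment> \<open>Here \<open>j\<close> is the shorter job: it delays \<open>i\<close> by at most
    \<open>proc I j\<close>, and \<open>i\<close> delays it by at most
    \<open>proc I j / \<alpha>\<close>.\<close>
  also have "\<dots> \<le> (\<Sum>j<n. real m * proc I j)
      + (\<Sum>j<n. \<Sum>i\<in>{i \<in> {..<n}. lex_less (proc I) j i}. c * proc I j)"
  proof (intro add_left_mono sum_mono)
    fix j i assume "j \<in> {..<n}" "i \<in> {i \<in> {..<n}. lex_less (proc I) j i}"
    thus "E (finish j) i + E (finish i) j \<le> c * proc I j"
      using state_finish_le[of j i] state_le_proc[of j "finish i"]
      by (simp add: c_def algebra_simps)
  qed
  also have "\<dots> = (\<Sum>j<n. real m * proc I j + real (z j) * (c * proc I j))"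
    by (simp add: z_def job_rank_def sum.distrib)
  also have "\<dots> = real m * (\<Sum>j<n. proc I j * (1 + c / real m * real (z j)))"
    unfolding sum_distrib_left using m by (intro sum.cong) (auto simp: field_simps)
  also have "\<dots> \<le> real m * (c * spt_cost m I)"
  proof (intro mult_left_mono)
    have "2 \<le> c" using alpha_pos alpha_le_1 by (simp add: c_def)
    thus "(\<Sum>j<n. proc I j * (1 + c / real m * real (z j))) \<le> c * spt_cost m I"
      unfolding z_def by (rule sum_pairs_le_spt_cost[OF valid machines])
  qed simp
  finally show ?thesis using m by (simp add: c_def)
qed

text \<open>The signal level is a threshold, so a phase that starts below it does not pass it. The
  induction needs the stronger bound with \<open>min\<close>.\<close>

lemma unsignalled_work:
  assumes "j < n"
  shows "(\<Sum>l<k. if E l j < signal_level I j then \<delta> l * r l j else 0) \<le> signal_level I j"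
proof -
  have "(\<Sum>l<k. if E l j < signal_level I j then \<delta> l * r l j else 0)
      \<le> min (E k j) (signal_level I j)"
  proof (induction k)
    case 0
    show ?case using signal_level_nonneg[OF assms] by simp
  next
    case (Suc k)
    show ?case
    proof (cases "E k j < signal_level I j")
      case True
      hence "j \<in> U k" using signal_level_le[OF assms] assms by (simp add: unfinished_def)
      hence "E (Suc k) j \<le> signal_level I j"
        using True by (intro state_Suc_le) (auto simp: thresholds_def)
      thus ?thesis using Suc True by simp
    next
      case False
      thus ?thesis using Suc gain_nonneg[of k j] by simp
    qed
  qed
  thus ?thesis by simp
qed

lemma consistent_bound:
  assumes sig: "\<And>j. j < n \<Longrightarrow> sig_frac I j = \<alpha>"
  shows "(\<Sum>j<n. \<tau> (finish j)) \<le> (1 + \<alpha>) * spt_cost m I"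
proof -
  obtain K where K: "U K = {}" using all_finish by auto
  define w where "w j = load m (job_rank (proc I) {..<n} j)" for j
  have level: "signal_level I j = \<alpha> * proc I j" if "j < n" for j
    using sig that by (simp add: signal_level_def)
  \<comment> \<open>Here \<open>signal_level I j / \<alpha>\<close> equals \<open>proc I j\<close>,
    so a promotion lasts until completion and an unpromoted unfinished job has not
    signalled.\<close>
  have unsignalled: "E l j < signal_level I j" if "j \<in> U l - P l" for l j
    using that level[of j] alpha_pos by (auto simp: unfinished_def promoted_def)
  have U_n: "U l \<subseteq> {..<n}" for l by (auto simp: unfinished_def)
  have P_U: "P l \<subseteq> U l" for l by (rule promoted_subset)
  have charge: "real (card (U l)) \<le> (\<Sum>j<n. r l j * w j) + (\<Sum>j\<in>U l - P l. r l j * w j)" for l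
    unfolding w_def
  proof (rule card_unfinished_le_charge[OF machines])
    fix i j assume i: "i \<in> P l" and j: "j \<in> U l - P l"
    have "min (E l i) (signal_level I i) \<le> E l j"
      using unfinished_dominates[of l j i] j by (simp add: unfinished_iff)
    hence "signal_level I i < signal_level I j"
      using unsignalled[OF j] i by (auto simp: promoted_def)
    moreover have "i < n" "j < n" using i j U_n P_U by blast+
    ultimately show "lex_less (proc I) i j"
      using alpha_pos by (simp add: level lex_less_def)
  next
    fix i j assume "i \<in> P l" "j \<in> P l"
    hence "i < n" "j < n" using U_n P_U by blast+
    thus "lex_less (signal_level I) i j \<longleftrightarrow> lex_less (proc I) i j"
      using alpha_pos by (simp add: lex_less_def level)
  qed
  \<comment> \<open>Each phase contributes its length once per unfinished job.\<close>
  have "(\<Sum>j<n. \<tau> (finish j)) = (\<Sum>j<n. \<Sum>l<K. if j \<in> U l then \<delta> l else 0)"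
  proof (rule sum.cong[OF refl])
    fix j assume "j \<in> {..<n}"
    have "finish j \<le> K" using K unfinished_iff[of j K] by auto
    thus "\<tau> (finish j) = (\<Sum>l<K. if j \<in> U l then \<delta> l else 0)"
      unfolding clock_def unfinished_iff by (intro sum.mono_neutral_cong_left) auto
  qed
  also have "\<dots> = (\<Sum>l<K. \<Sum>j<n. if j \<in> U l then \<delta> l else 0)" by (rule sum.swap)
  also have "\<dots> = (\<Sum>l<K. \<delta> l * real (card (U l)))"
  proof (rule sum.cong[OF refl])
    fix l
    have "(\<Sum>j<n. if j \<in> U l then \<delta> l else 0) = (\<Sum>j\<in>U l. \<delta> l)"
      by (rule sum.mono_neutral_cong_right) (use U_n in auto)
    thus "(\<Sum>j<n. if j \<in> U l then \<delta> l else 0) = \<delta> l * real (card (U l))" by simp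
  qed
  also have "\<dots> \<le> (\<Sum>l<K. \<Sum>j<n.
      w j * (\<delta> l * r l j + (if E l j < signal_level I j then \<delta> l * r l j else 0)))"
  proof (rule sum_mono)
    fix l
    have "(\<Sum>j\<in>U l - P l. r l j * w j)
        = (\<Sum>j<n. if j \<in> U l - P l then r l j * w j else 0)"
      by (rule sum.mono_neutral_cong_left) (use U_n in auto)
    also have "\<dots> \<le> (\<Sum>j<n. w j * (if E l j < signal_level I j then r l j else 0))"
      using unsignalled load_nonneg by (intro sum_mono) (auto simp: w_def rate_nonneg)
    finally have "real (card (U l))
        \<le> (\<Sum>j<n. w j * (r l j + (if E l j < signal_level I j then r l j else 0)))"
      using charge[of l] unfolding distrib_left sum.distrib
      by (simp add: mult.commute)
    hence "\<delta> l * real (card (U l))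
        \<le> \<delta> l * (\<Sum>j<n. w j * (r l j + (if E l j < signal_level I j then r l j else 0)))"
      using delay_pos by (intro mult_left_mono) (auto simp: less_imp_le)
    also have "\<dots> = (\<Sum>j<n.
        w j * (\<delta> l * r l j + (if E l j < signal_level I j then \<delta> l * r l j else 0)))"
      unfolding sum_distrib_left by (intro sum.cong) (auto simp: algebra_simps)
    finally show "\<delta> l * real (card (U l)) \<le> (\<Sum>j<n.
        w j * (\<delta> l * r l j + (if E l j < signal_level I j then \<delta> l * r l j else 0)))" .
  qed
  also have "\<dots> = (\<Sum>j<n. w j *
      (E K j + (\<Sum>l<K. if E l j < signal_level I j then \<delta> l * r l j else 0)))"
    by (subst sum.swap) (simp add: sum.distrib flip: sum_distrib_left state_eq_sum)
  \<comment> \<open>The second summand is work before the signal, at most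
    \<open>signal_level I j = \<alpha> * proc I j\<close>.\<close>
  also have "\<dots> \<le> (\<Sum>j<n. w j * (proc I j + \<alpha> * proc I j))"
    using state_le_proc unsignalled_work level load_nonneg
    by (intro sum_mono mult_left_mono add_mono) (auto simp: w_def)
  also have "\<dots> = (1 + \<alpha>) * spt_cost m I"
    by (simp add: spt_cost_def w_def sum_distrib_left algebra_simps)
  finally show ?thesis .
qed

lemma total_le_mult_opt:
  assumes "(\<Sum>j<n. \<tau> (finish j)) \<le> c * spt_cost m I" "0 \<le> c"
  shows "total_completion_time I A \<le> ereal c * opt m I"
proof -
  have "total_completion_time I A \<le> ereal (c * spt_cost m I)"
    using total_completion_time_le assms(1) by (meson ereal_less_eq(3) order_trans)
  also have "\<dots> = ereal c * ereal (spt_cost m I)" by simp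
  also have "\<dots> \<le> ereal c * opt m I"
    using assms(2) by (intro ereal_mult_left_mono spt_cost_le_opt valid machines) simp
  finally show ?thesis .
qed

end

section \<open>Non-clairvoyance: two runs with equal observations up to time
  \<open>t\<close>\<close>

locale run_pair = I: run \<alpha> m I + J: run \<alpha> m J
  for \<alpha> :: real and m :: nat and I J :: job_instance +
  fixes t :: real
  assumes num_jobs_eq: "num_jobs I = num_jobs J"
    and observation_eq: "\<And>s. 0 \<le> s \<Longrightarrow> s \<le> t \<Longrightarrow>
          observation I (algorithm \<alpha> m I) s = observation J (algorithm \<alpha> m J) s"
begin

lemma run_pair_swap: "run_pair \<alpha> m J I t"
  by unfold_locales (simp_all add: num_jobs_eq observation_eq)

lemma signalled_iff:
  assumes "0 \<le> s" "s \<le> t" "j < I.n"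
  shows "signal_level I j \<le> elapsed I.A j s \<longleftrightarrow> signal_level J j \<le> elapsed J.A j s"
  using observation_eq[OF assms(1,2)] assms(3)
  by (auto simp: observation_def signalled_def signal_level_def num_jobs_eq set_eq_iff)

lemma completed_iff:
  assumes "0 \<le> s" "s \<le> t" "j < I.n"
  shows "proc I j \<le> elapsed I.A j s \<longleftrightarrow> proc J j \<le> elapsed J.A j s"
  using observation_eq[OF assms(1,2)] assms(3)
  by (auto simp: observation_def completed_def num_jobs_eq set_eq_iff)

context
  fixes k :: nat
  assumes same: "\<And>l. l \<le> k \<Longrightarrow> I.E l = J.E l \<and> I.\<tau> l = J.\<tau> l" and now: "I.\<tau> k \<le> t"
begin

text \<open>The signal of \<open>I\<close> falls on an exact clock value of the common history. The
  observation at that time shows that \<open>J\<close> has signalled too, at the same elapsed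
  time.\<close>

lemma signal_level_ge:
  assumes j: "j < I.n" and sig: "signal_level I j \<le> I.E k j"
  shows "signal_level J j \<le> signal_level I j"
proof -
  obtain l where l: "l \<le> k" "I.E l j = signal_level I j"
    by (rule I.threshold_hit[OF j _ I.signal_level_nonneg[OF j] I.signal_level_le[OF j] sig])
      (simp add: thresholds_def)
  have "I.\<tau> l \<le> t" using I.clock_mono[OF l(1)] now by simp
  hence "signal_level J j \<le> elapsed J.A j (I.\<tau> l)"
    using signalled_iff[OF I.clock_nonneg _ j, of l] l by (simp add: I.elapsed_clock)
  thus ?thesis using same[OF l(1)] l J.elapsed_clock[of j l] by simp
qed

lemma elapsed_now: "elapsed I.A j (I.\<tau> k) = I.E k j" "elapsed J.A j (I.\<tau> k) = I.E k j"
  using same[of k] I.elapsed_clock[of j k] J.elapsed_clock[of j k] by simp_all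

lemma signalled_now_iff:
  "j < I.n \<Longrightarrow> signal_level I j \<le> I.E k j \<longleftrightarrow> signal_level J j \<le> I.E k j"
  using signalled_iff[OF I.clock_nonneg now, of j] by (simp add: elapsed_now)

lemma unfinished_eq: "unfinished I (I.E k) = unfinished J (I.E k)"
  using completed_iff[OF I.clock_nonneg now] num_jobs_eq
  by (auto simp: unfinished_def elapsed_now not_le[symmetric])

end

end

context run_pair
begin

lemma signal_level_eq:
  assumes "\<And>l. l \<le> k \<Longrightarrow> I.E l = J.E l \<and> I.\<tau> l = J.\<tau> l" "I.\<tau> k \<le> t"
    and "j < I.n" "signal_level I j \<le> I.E k j"
  shows "signal_level J j = signal_level I j"
proof (rule antisym)
  interpret swap: run_pair \<alpha> m J I t by (rule run_pair_swap)
  show "signal_level J j \<le> signal_level I j" by (rule signal_level_ge[OF assms])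
  show "signal_level I j \<le> signal_level J j"
    by (rule swap.signal_level_ge[of k])
      (use assms signalled_now_iff[OF assms(1-3)] num_jobs_eq in auto)
qed

text \<open>Promotion and the order among promoted jobs depend only on the levels of signalled jobs,
  on which the instances agree.\<close>

lemma rate_eq:
  assumes same: "\<And>l. l \<le> k \<Longrightarrow> I.E l = J.E l \<and> I.\<tau> l = J.\<tau> l" and now: "I.\<tau> k \<le> t"
  shows "rate \<alpha> m I (I.E k) = rate \<alpha> m J (I.E k)"
proof -
  have U: "unfinished J (I.E k) = unfinished I (I.E k)"
    using unfinished_eq[OF same now] by simp
  have sig: "signal_level J j = signal_level I j"
    if "j \<in> I.U k" "signal_level I j \<le> I.E k j" for j
    using signal_level_eq[OF same now, of j] that by (simp add: unfinished_def)
  have iff: "signal_level I j \<le> I.E k j \<longleftrightarrow> signal_level J j \<le> I.E k j" if "j \<in> I.U k" for j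
    using signalled_now_iff[OF same now, of j] that by (simp add: unfinished_def)
  have P: "promoted \<alpha> J (I.E k) = promoted \<alpha> I (I.E k)"
    using sig iff by (auto simp: promoted_def U)
  have "{i \<in> promoted \<alpha> I (I.E k). lex_less (signal_level J) i j}
      = {i \<in> promoted \<alpha> I (I.E k). lex_less (signal_level I) i j}"
    if "j \<in> promoted \<alpha> I (I.E k)" for j
    using sig that by (auto simp: promoted_def lex_less_def)
  thus ?thesis by (auto simp: rate_def fun_eq_iff P U)
qed

text \<open>An event of \<open>I\<close> that \<open>J\<close> has not anticipated shows up in the observation at the time of
  the event. The end of a promotion is invisible, but its time is determined by the signal.\<close>

lemma delay_ge:
  assumes same: "\<And>l. l \<le> k \<Longrightarrow> I.E l = J.E l \<and> I.\<tau> l = J.\<tau> l"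
    and t: "I.\<tau> (Suc k) \<le> t"
  shows "J.\<delta> k \<le> I.\<delta> k"
proof (rule ccontr)
  assume "\<not> J.\<delta> k \<le> I.\<delta> k"
  hence less: "I.\<delta> k < J.\<delta> k" by simp
  define e where "e = I.E k"
  define s where "s = I.\<tau> (Suc k)"
  have E: "I.E k = e" "J.E k = e" and \<tau>: "I.\<tau> k = J.\<tau> k" using same[of k] by (auto simp: e_def)
  have now: "I.\<tau> k \<le> t" using I.clock_mono[of k "Suc k"] t by simp
  have s: "0 \<le> s" "s \<le> t" using t I.clock_nonneg by (simp_all add: s_def)
  have U: "unfinished J e = unfinished I e"
    using unfinished_eq[OF same now] by (simp add: E)
  have rate: "rate \<alpha> m J e = rate \<alpha> m I e"
    using rate_eq[OF same now] by (simp add: E)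
  have "unfinished I e \<noteq> {}" using less U by (auto simp: delay_def E)
  then obtain j \<theta> where j: "(j, \<theta>) \<in> pending \<alpha> I e" "0 < rate \<alpha> m I e j"
    "e j + delay \<alpha> m I e * rate \<alpha> m I e j = \<theta>"
    by (rule delay_event[OF I.machines])
  have jU: "j \<in> unfinished I e" and jn: "j < I.n" and e_less: "e j < \<theta>"
    using j(1) by (auto simp: pending_def unfinished_def)
  have elapsed: "elapsed I.A j s = \<theta>" "elapsed J.A j s = \<theta>"
  proof -
    show "elapsed I.A j s = \<theta>" using j(3) I.elapsed_clock[of j "Suc k"] by (simp add: s_def E)
    have "J.\<tau> k \<le> s" "s \<le> J.\<tau> (Suc k)"
      using I.delay_pos[of k] less \<tau> by (simp_all add: s_def I.clock_Suc J.clock_Suc)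
    thus "elapsed J.A j s = \<theta>"
      using j(3) \<tau> J.elapsed_phase[of k s j] by (simp add: E rate s_def I.clock_Suc)
  qed
  \<comment> \<open>Phase \<open>k\<close> of \<open>J\<close> lasts beyond \<open>s\<close>, so at
    \<open>s\<close> job \<open>j\<close> is strictly below every threshold in \<open>J\<close> that
    exceeds \<open>e j\<close>. Each case below exhibits such a threshold of at most
    \<open>\<theta>\<close>.\<close>
  have J_strict: "\<theta> < \<theta>'" if "\<theta>' \<in> thresholds \<alpha> J j" "e j < \<theta>'" for \<theta>'
    using below_threshold(2)[of j \<theta>' \<alpha> J e "delay \<alpha> m I e" m] that jU less j(3)
    by (simp add: pending_def U rate E)
  have not_sig: False if "e j < signal_level I j" "\<theta> = signal_level I j"
  proof -
    have "\<not> signal_level J j \<le> e j"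
      using signalled_now_iff[OF same now jn] that by (simp add: E)
    moreover have "signal_level J j \<le> \<theta>"
      using signalled_iff[OF s jn] elapsed that by simp
    ultimately show False using J_strict[of "signal_level J j"] by (simp add: thresholds_def)
  qed
  consider "\<theta> = proc I j" | "\<theta> = signal_level I j" | "\<theta> = signal_level I j / \<alpha>"
    using j(1) by (auto simp: pending_def thresholds_def)
  thus False
  proof cases
    case 1
    hence "proc J j \<le> \<theta>" using completed_iff[OF s jn] elapsed by simp
    moreover have "e j < proc J j" using jU U by (auto simp: unfinished_def)
    ultimately show False using J_strict[of "proc J j"] by (simp add: thresholds_def)
  next
    case 2
    thus False using not_sig e_less by simp
  next
    case 3
    show False
    proof (cases "signal_level I j \<le> e j")
      case True
      hence "signal_level J j = signal_level I j"
        using signal_level_eq[OF same now jn] by (simp add: E)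
      thus False using J_strict[of \<theta>] 3 e_less by (simp add: thresholds_def)
    next
      \<comment> \<open>The signal was still pending when the phase began and cannot be overtaken.
        So it coincides with the end of the promotion and is itself the visible event.\<close>
      case False
      hence "(j, signal_level I j) \<in> pending \<alpha> I e"
        using jU by (simp add: pending_def thresholds_def)
      hence "\<theta> \<le> signal_level I j"
        using below_threshold(1)[of j "signal_level I j" \<alpha> I e "delay \<alpha> m I e" m] j(3) by simp
      moreover have "signal_level I j \<le> \<theta>"
        using I.le_divide_alpha[OF I.signal_level_nonneg[OF jn]] 3 by simp
      ultimately show False using not_sig False by simp
    qed
  qed
qed

text \<open>\<open>delay_ge\<close> in both directions makes the delays equal. The swapped use
  requires that \<open>J\<close> ends the phase by time \<open>t\<close>, which the first inequality
  ensures.\<close>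

lemma same_history:
  assumes "I.\<tau> k \<le> t" "l \<le> k"
  shows "I.E l = J.E l \<and> I.\<tau> l = J.\<tau> l"
  using assms
proof (induction k arbitrary: l)
  case (Suc k)
  interpret swap: run_pair \<alpha> m J I t by (rule run_pair_swap)
  have now: "I.\<tau> k \<le> t" using Suc.prems I.clock_mono[of k "Suc k"] by simp
  hence same: "\<And>l. l \<le> k \<Longrightarrow> I.E l = J.E l \<and> I.\<tau> l = J.\<tau> l" using Suc.IH by simp
  have le: "J.\<delta> k \<le> I.\<delta> k" by (rule delay_ge[OF same Suc.prems(1)])
  hence "J.\<tau> (Suc k) \<le> t"
    using Suc.prems(1) same[of k] by (simp add: I.clock_Suc J.clock_Suc)
  hence "I.\<delta> k \<le> J.\<delta> k" using same by (intro swap.delay_ge) auto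
  hence \<delta>: "I.\<delta> k = J.\<delta> k" using le by simp
  have "I.E (Suc k) = J.E (Suc k) \<and> I.\<tau> (Suc k) = J.\<tau> (Suc k)"
    using \<delta> same[of k] rate_eq[OF same now] by (simp add: I.clock_Suc J.clock_Suc)
  thus ?case using same Suc.prems(2) by (cases "l = Suc k") auto
qed simp

lemma algorithm_eq:
  assumes "0 \<le> t"
  shows "I.A j t = J.A j t"
proof -
  interpret swap: run_pair \<alpha> m J I t by (rule run_pair_swap)
  obtain k where k: "I.\<tau> k \<le> t" "t < I.\<tau> (Suc k)" by (rule I.obtain_phase[OF assms])
  have same: "\<And>l. l \<le> k \<Longrightarrow> I.E l = J.E l \<and> I.\<tau> l = J.\<tau> l" by (rule same_history[OF k(1)])
  \<comment> \<open>Had \<open>J\<close> left phase \<open>k\<close> by time \<open>t\<close>, the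
    swapped \<open>same_history\<close> would make \<open>I\<close> leave it at the same
    time.\<close>
  have "t < J.\<tau> (Suc k)"
  proof (rule ccontr)
    assume "\<not> t < J.\<tau> (Suc k)"
    hence "J.\<tau> (Suc k) = I.\<tau> (Suc k)" using swap.same_history[of "Suc k" "Suc k"] by simp
    thus False using k \<open>\<not> t < J.\<tau> (Suc k)\<close> by simp
  qed
  hence "J.A j t = J.r k j" using same[of k] k(1) by (intro J.algorithm_phase) auto
  also have "\<dots> = I.r k j" using rate_eq[OF same k(1)] same[of k] by simp
  finally show ?thesis using I.algorithm_phase[OF k] by simp
qed

end

lemma non_clairvoyant_algorithm:
  assumes "0 < \<alpha>" "\<alpha> \<le> 1" "m \<ge> 1"
  shows "non_clairvoyant (algorithm \<alpha> m)"
  unfolding non_clairvoyant_def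
proof (intro allI impI)
  fix I J :: job_instance and t :: real and j
  assume *: "valid_instance I \<and> valid_instance J \<and> num_jobs I = num_jobs J \<and> 0 \<le> t \<and>
    (\<forall>s\<in>{0..t}. observation I (algorithm \<alpha> m I) s = observation J (algorithm \<alpha> m J) s)"
  then interpret run_pair \<alpha> m I J t using assms by unfold_locales auto
  show "algorithm \<alpha> m I j t = algorithm \<alpha> m J j t" using algorithm_eq * by simp
qed

theorem theorem8:
  fixes \<alpha> :: real and m :: nat
  assumes "0 < \<alpha>" and "\<alpha> \<le> 1" and "m \<ge> 1"
  shows "\<exists>A. signal_algorithm m A \<and> consistent m \<alpha> (1 + \<alpha>) A \<and> robust m (1 + 1 / \<alpha>) A"
proof (intro exI conjI)
  have run: "run \<alpha> m I" if "valid_instance I" for I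
    using assms that by unfold_locales
  show "signal_algorithm m (algorithm \<alpha> m)"
    using run.feasible[OF run] non_clairvoyant_algorithm[OF assms]
    by (simp add: signal_algorithm_def)
  show "consistent m \<alpha> (1 + \<alpha>) (algorithm \<alpha> m)"
    unfolding consistent_def
    using run.total_le_mult_opt[OF run run.consistent_bound[OF run]] assms by auto
  show "robust m (1 + 1 / \<alpha>) (algorithm \<alpha> m)"
    unfolding robust_def
    using run.total_le_mult_opt[OF run run.robust_bound[OF run]] assms by auto
qed

end
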